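(* Let $\alpha>0$ and $\nu\in\mathbb{R}$. Define $$M(\alpha,\nu)=-\sum_{n=1}^\infty\frac{\cos 2n\pi\nu}{n\,(e^{2n\pi/\alpha}-1)}-\frac{2}{\pi}\,\mathrm{PV}\!\int_0^\infty\sum_{n=1}^\infty\frac{\sin 2n\nu\pi t}{n\,(e^{2n\pi t/\alpha}-1)}\,\frac{dt}{1-t^2}$$ and $$P^-(\alpha,\nu)=\int_{\ell_r^-}\frac{\sin\nu t}{e^{t/\alpha}-1}\Bigl(\cot\frac t2-\frac 2t\Bigr)\frac{dt}{t},$$ where, for a fixed $r\in(0,1)$, $\ell_r^-$ is the path from $0$ to $+\infty$ consisting of the segment $(0,2\pi-r)$ followed, for each integer $n\ge1$, by the semicircle $C_{n,r}^-$ of center $2\pi n$ and radius $r$ lying in the lower half-plane, traversed from $2\pi n-r$ to $2\pi n+r$, and then the segment $(2\pi n+r,2\pi(n+1)-r)$. Then $$M(\alpha,\nu)=\log\bigl(e^{2\pi\nu i-2\pi/\alpha};e^{-2\pi/\alpha}\bigr)_\infty+P^-(\alpha,\nu).$$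
   Context: For $|q|<1$, $(x;q)_\infty=\prod_{n\ge0}(1-xq^n)$. $\mathrm{PV}\int$ denotes the Cauchy principal value (singularity at $t=1$). The logarithm of the infinite product is $\sum_{n\ge0}\log(1-xq^n)$ with principal logarithms. *)

theory Defs
  imports "HOL-Complex_Analysis.Complex_Analysis"
begin

text \<open>Cauchy principal value of \<open>f\<close> over \<open>A\<close> at the singularity \<open>c\<close>: the symmetric
  neighbourhood \<open>{c - \<epsilon> <..< c + \<epsilon>}\<close> is removed and \<open>\<epsilon>\<close> tends to 0 from above.\<close>

definition has_PV_integral :: "(real \<Rightarrow> real) \<Rightarrow> real \<Rightarrow> real set \<Rightarrow> real \<Rightarrow> bool" where
  "has_PV_integral f I A c \<longleftrightarrow>
     (\<forall>\<epsilon>>0. set_integrable lborel (A - {c - \<epsilon><..<c + \<epsilon>}) f) \<and>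
     ((\<lambda>\<epsilon>. LBINT t:A - {c - \<epsilon><..<c + \<epsilon>}. f t) \<longlongrightarrow> I) (at_right 0)"

definition PV_integral :: "real set \<Rightarrow> real \<Rightarrow> (real \<Rightarrow> real) \<Rightarrow> real" where
  "PV_integral A c f = (THE I. has_PV_integral f I A c)"

definition log_qpochhammer :: "complex \<Rightarrow> complex \<Rightarrow> complex" where
  "log_qpochhammer x q = (\<Sum>n. Ln (1 - x * q ^ n))"

definition M_cos_term :: "real \<Rightarrow> real \<Rightarrow> nat \<Rightarrow> real" where
  "M_cos_term \<alpha> \<nu> n = cos (2 * real n * pi * \<nu>) / (real n * (exp (2 * real n * pi / \<alpha>) - 1))"

definition M_sin_term :: "real \<Rightarrow> real \<Rightarrow> real \<Rightarrow> nat \<Rightarrow> real" where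
  "M_sin_term \<alpha> \<nu> t n =
     sin (2 * real n * \<nu> * pi * t) / (real n * (exp (2 * real n * pi * t / \<alpha>) - 1))"

definition M_integrand :: "real \<Rightarrow> real \<Rightarrow> real \<Rightarrow> real" where
  "M_integrand \<alpha> \<nu> t = (\<Sum>n. M_sin_term \<alpha> \<nu> t (Suc n)) * (1 / (1 - t\<^sup>2))"

definition M_fun :: "real \<Rightarrow> real \<Rightarrow> real" where
  "M_fun \<alpha> \<nu> = - (\<Sum>n. M_cos_term \<alpha> \<nu> (Suc n))
                - 2 / pi * PV_integral {0<..} 1 (M_integrand \<alpha> \<nu>)"

text \<open>The initial piece of the path \<open>\<ell>\<^sub>r\<^sup>-\<close> from \<open>0\<close> to \<open>2\<pi>(N+1) - r\<close>, passing below
  \<open>2\<pi>, \<dots>, 2\<pi>N\<close>. The angle running from \<open>\<pi>\<close> to \<open>2\<pi>\<close> gives the lower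
  semicircle from \<open>2\<pi>n - r\<close> to \<open>2\<pi>n + r\<close>.\<close>

fun ell_minus :: "real \<Rightarrow> nat \<Rightarrow> real \<Rightarrow> complex" where
  "ell_minus r 0 = linepath 0 (of_real (2 * pi - r))"
| "ell_minus r (Suc N) =
     ell_minus r N
     +++ part_circlepath (of_real (2 * pi * real (Suc N))) r pi (2 * pi)
     +++ linepath (of_real (2 * pi * real (Suc N) + r)) (of_real (2 * pi * real (Suc N + 1) - r))"

definition has_ell_minus_integral :: "(complex \<Rightarrow> complex) \<Rightarrow> complex \<Rightarrow> real \<Rightarrow> bool" where
  "has_ell_minus_integral f I r \<longleftrightarrow>
     (\<forall>N. f contour_integrable_on ell_minus r N) \<and>
     (\<lambda>N. contour_integral (ell_minus r N) f) \<longlonglongrightarrow> I"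

definition ell_minus_integral :: "real \<Rightarrow> (complex \<Rightarrow> complex) \<Rightarrow> complex" where
  "ell_minus_integral r f = (THE I. has_ell_minus_integral f I r)"

definition P_minus_integrand :: "real \<Rightarrow> real \<Rightarrow> complex \<Rightarrow> complex" where
  "P_minus_integrand \<alpha> \<nu> t =
     sin (of_real \<nu> * t) / (exp (t / of_real \<alpha>) - 1) * (cot (t / 2) - 2 / t) * (1 / t)"

definition P_minus :: "real \<Rightarrow> real \<Rightarrow> real \<Rightarrow> complex" where
  "P_minus r \<alpha> \<nu> = ell_minus_integral r (P_minus_integrand \<alpha> \<nu>)"

end

theory Submission
  imports Defs
begin

text \<open>Write \<open>g t = sin (\<nu> t) / (e\<^bsup>t/\<alpha>\<^esup> - 1)\<close> and \<open>F t = (\<Sum>n. g (2 \<pi> n t) / n)\<close>. In a narrow cone around the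
  positive axis \<open>g\<close> is bounded by a decaying exponential of \<open>Re t\<close>, so both integrals can be rotated onto a ray
  \<open>w (0, \<infinity>)\<close> slightly below the axis, away from all poles. The path \<open>\<ell>\<^sub>r\<^sup>-\<close> passes below the poles,
  hence rotates without residues; the principal value of \<open>F t / (1 - t\<^sup>2)\<close> differs from its ray integral by half a
  residue, \<open>i \<pi> F(1) / 2\<close>. On the ray the expansion \<open>(cot (t/2) - 2/t) / t = \<Sum>n. 4 / (t\<^sup>2 - (2 \<pi> n)\<^sup>2)\<close> may be
  integrated termwise, and the substitution \<open>t = 2 \<pi> n s\<close> in the \<open>n\<close>-th term turns one ray integral into
  \<open>- 2 / \<pi>\<close> times the other. The half residue contributes \<open>- i F(1)\<close>, which together with the
  cosine part of \<open>M\<close> is the power series expansion of the logarithm of the product.\<close>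

text \<open>On the axis every term of the expansion has a pole on the path, and the principal value
  is not an absolutely convergent integral. On a slanted ray the distance to a pole \<open>a\<close>
  is at least a fixed multiple of \<open>a\<close>, so the denominators have a lower bound of order
  n^2, uniform along the ray, and this is the majorant behind the exchange of sum and integral.
  Positive dilations preserve the ray, and each of them carries its own pole 2 \<pi> n to the single
  pole 1.

  The price of leaving the axis is the growth of sin (\<nu> t), hence a narrow cone. Near 0 the
  series F is controlled only by a multiple of 1 / sqrt (Re t), but the segments that join ray and
  axis have length proportional to Re t, so they vanish there all the same. Both rotations use a
  primitive on a convex or slit domain: paths with the same ends have the same integral, and the
  slit, drawn upwards from the pole, leaves room for a passage below it.\<close>

section \<open>The partial fraction expansion of the cotangent\<close>

text \<open>This is the logarithmic derivative of the reflection formula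
  \<open>Gamma z * Gamma (1 - z) = pi / sin (pi * z)\<close>, with the recurrence of
  \<open>Digamma\<close> absorbing 1 / z.\<close>

lemma cot_minus_inverse_eq_Digamma:
  fixes z :: complex
  assumes z: "z \<notin> \<int>"
  shows "pi * cot (pi * z) - 1 / z = Digamma (1 - z) - Digamma (1 + z)"
proof -
  have z0: "z \<noteq> 0" using z by auto
  have nz: "z \<notin> \<int>\<^sub>\<le>\<^sub>0" "1 - z \<notin> \<int>\<^sub>\<le>\<^sub>0" "z + 1 \<notin> \<int>\<^sub>\<le>\<^sub>0"
    using z nonpos_Ints_subset_Ints Ints_diff[of 1 "1 - z"] Ints_diff[of "z + 1" 1] by auto
  have s: "sin (pi * z) \<noteq> 0"
    using z by (auto simp: Complex_Transcendental.sin_eq_0)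
  have refl: "Digamma (1 - z) - Digamma z = pi * cot (pi * z)"
  proof -
    have "((\<lambda>z. Gamma z * Gamma (1 - z)) has_field_derivative
        (Gamma z * Digamma z * Gamma (1 - z) - Gamma z * (Gamma (1 - z) * Digamma (1 - z)))) (at z)"
      using nz by (auto intro!: derivative_eq_intros simp: algebra_simps)
    moreover have "((\<lambda>z. Gamma z * Gamma (1 - z)) has_field_derivative
        (- pi * (cos (pi * z) * pi) / (sin (pi * z))\<^sup>2)) (at z)"
    proof -
      have "((\<lambda>z. pi / sin (pi * z)) has_field_derivative
        (- pi * (cos (pi * z) * pi) / (sin (pi * z))\<^sup>2)) (at z)"
        using s by (auto intro!: derivative_eq_intros simp: power2_eq_square)
      then show ?thesis by (simp add: Gamma_reflection_complex)
    qed
    ultimately have "Gamma z * Gamma (1 - z) * (Digamma z - Digamma (1 - z)) =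
        (- pi * (cos (pi * z) * pi) / (sin (pi * z))\<^sup>2)"
      using DERIV_unique by (fastforce simp: algebra_simps)
    also have "\<dots> = (pi / sin (pi * z)) * (- (pi * cot (pi * z)))"
      by (simp add: cot_def power2_eq_square)
    finally have "Digamma z - Digamma (1 - z) = - (pi * cot (pi * z))"
      unfolding Gamma_reflection_complex using s by (subst (asm) mult_left_cancel) auto
    then show ?thesis by (simp add: algebra_simps)
  qed
  then show ?thesis using z0 Digamma_plus1[OF z0] by (simp add: add.commute[of 1 z])
qed

text \<open>With z = t / (2 \<pi>), the series of \<open>Digamma\<close> at 1 - z and at 1 + z are
  subtracted: the harmonic terms and the Euler-Mascheroni constant cancel.\<close>

lemma cot_minus_inverse_sums:
  fixes t :: complex
  assumes "t / (2 * pi) \<notin> \<int>"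
  shows "(\<lambda>n. - 4 / ((2 * pi * real (Suc n))\<^sup>2 - t\<^sup>2)) sums ((cot (t / 2) - 2 / t) * (1 / t))"
proof -
  define z where "z = t / (2 * pi)"
  have z: "z \<notin> \<int>" using assms by (simp add: z_def)
  have z0: "z \<noteq> 0" using z by auto
  have nz: "1 - z \<noteq> 0" "1 + z \<noteq> 0"
    using z by (auto simp: add_eq_0_iff)
  have D: "(\<lambda>k. inverse (of_nat (Suc k)) - inverse (u + of_nat k)) sums (Digamma u + euler_mascheroni)"
    if "u \<noteq> 0" for u :: complex
    using summable_sums[OF summable_Digamma[OF that]] by (simp add: Digamma_def)
  have "(\<lambda>k. (inverse (of_nat (Suc k)) - inverse ((1 - z) + of_nat k))
            - (inverse (of_nat (Suc k)) - inverse ((1 + z) + of_nat k))) sums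
        ((Digamma (1 - z) + euler_mascheroni) - (Digamma (1 + z) + euler_mascheroni))"
    using nz by (intro sums_diff D)
  also have "(Digamma (1 - z) + euler_mascheroni) - (Digamma (1 + z) + euler_mascheroni)
      = pi * cot (pi * z) - 1 / z"
    by (simp add: cot_minus_inverse_eq_Digamma[OF z])
  also have "(\<lambda>k. (inverse (of_nat (Suc k)) - inverse ((1 - z) + of_nat k))
            - (inverse (of_nat (Suc k)) - inverse ((1 + z) + of_nat k))) =
      (\<lambda>k. - 2 * z / ((of_nat (Suc k))\<^sup>2 - z\<^sup>2))"
  proof
    fix k
    have "of_nat (Suc k) + z \<noteq> 0"
      using z by (auto simp: add_eq_0_iff simp del: of_nat_Suc)
    moreover have "of_nat (Suc k) - z \<noteq> 0" using z by auto
    moreover have "(of_nat (Suc k))\<^sup>2 - z\<^sup>2 = (of_nat (Suc k) - z) * (of_nat (Suc k) + z)"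
      by (simp add: power2_eq_square algebra_simps)
    moreover have "(1 - z) + of_nat k = of_nat (Suc k) - z" "(1 + z) + of_nat k = of_nat (Suc k) + z"
      by simp_all
    ultimately show "(inverse (of_nat (Suc k)) - inverse ((1 - z) + of_nat k))
            - (inverse (of_nat (Suc k)) - inverse ((1 + z) + of_nat k)) =
        - 2 * z / ((of_nat (Suc k))\<^sup>2 - z\<^sup>2)"
      by (simp only:) (simp add: field_simps)
  qed
  \<comment> \<open>The factor splits as 1 / \<pi>, which turns \<pi> cot (\<pi> z) - 1 / z into cot
    (t / 2) - 2 / t, and 1 / (2 \<pi> z), which is 1 / t.\<close>
  finally have "(\<lambda>k. (1 / (2 * pi\<^sup>2 * z)) * (- 2 * z / ((of_nat (Suc k))\<^sup>2 - z\<^sup>2))) sums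
      ((1 / (2 * pi\<^sup>2 * z)) * (pi * cot (pi * z) - 1 / z))"
    by (rule sums_mult)
  moreover have "(1 / (2 * pi\<^sup>2 * z)) * (pi * cot (pi * z) - 1 / z) = (cot (t / 2) - 2 / t) * (1 / t)"
    using z0 unfolding z_def by (simp add: field_simps power2_eq_square)
  moreover have "(1 / (2 * pi\<^sup>2 * z)) * (- 2 * z / ((of_nat (Suc k))\<^sup>2 - z\<^sup>2))
      = - 4 / ((2 * pi * real (Suc k))\<^sup>2 - t\<^sup>2)" for k
  proof -
    have "(2 * pi * real (Suc k))\<^sup>2 - t\<^sup>2 = 4 * pi\<^sup>2 * ((of_nat (Suc k))\<^sup>2 - z\<^sup>2)"
      unfolding z_def by (simp add: field_simps power2_eq_square)
    then show ?thesis using z0 by (simp only:) (simp add: divide_simps)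
  qed
  ultimately show ?thesis by simp
qed

text \<open>Mean value inequality on a strip where cos is bounded by exp |Im z|. The factor
  \<open>norm z\<close> is kept because it will cancel the zero of exp (t / \<alpha>) - 1 at
  0.\<close>

lemma norm_sin_le: "norm (sin z) \<le> norm z * exp \<bar>Im z\<bar>" for z :: complex
proof -
  define S where "S = {u. \<bar>Im u\<bar> \<le> \<bar>Im z\<bar>}"
  have S: "S = {u. Im u \<le> \<bar>Im z\<bar>} \<inter> {u. Im u \<ge> - \<bar>Im z\<bar>}" by (auto simp: S_def)
  have "norm (sin z - sin 0) \<le> exp \<bar>Im z\<bar> * norm (z - 0)"
  proof (rule field_differentiable_bound[of S])
    show "convex S" unfolding S
      by (intro convex_Int convex_halfspace_Im_le convex_halfspace_Im_ge)
    show "(sin has_field_derivative cos u) (at u within S)" for u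
      by (auto intro!: derivative_eq_intros)
    show "norm (cos u) \<le> exp \<bar>Im z\<bar>" if "u \<in> S" for u
    proof -
      have "norm (cos u) \<le> (norm (exp (\<i> * u)) + norm (exp (- (\<i> * u)))) / 2"
        by (simp only: cos_exp_eq norm_divide norm_numeral) (intro divide_right_mono norm_triangle_ineq, simp)
      also have "\<dots> \<le> (exp \<bar>Im z\<bar> + exp \<bar>Im z\<bar>) / 2"
        using that by (intro divide_right_mono add_mono) (auto simp: S_def)
      finally show ?thesis by simp
    qed
  qed (auto simp: S_def)
  then show ?thesis by (simp add: mult.commute)
qed

section \<open>Integrals along rays and primitives in slit domains\<close>

text \<open>The left side is 2 exp y sinh y, and sinh y >= y. Half of the exponent survives beside a
  linear factor of the right order at 0.\<close>

lemma exp_minus_1_ge: "exp (2 * y) - 1 \<ge> exp y * (2 * y)" if "y \<ge> 0" for y :: real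
proof -
  have "exp y * (2 * y) \<le> exp y * (exp y - inverse (exp y))"
    using real_le_x_sinh[OF that] by (intro mult_left_mono) auto
  also have "\<dots> = exp (2 * y) - 1"
    by (simp add: right_diff_distrib flip: exp_add)
  finally show ?thesis .
qed

text \<open>Trades decay for a power: with y proportional to n Re t it improves a coefficient 1 / n
  to n powr (-3/2).\<close>

lemma exp_minus_le_inverse_sqrt: "exp (- y) \<le> 1 / sqrt y" if "y > 0" for y :: real
proof -
  have "sqrt y \<le> exp y"
  proof -
    have "sqrt (y * 1) \<le> (y + 1) / 2"
      using that by (intro arith_geo_mean_sqrt) auto
    also have "\<dots> \<le> 1 + y" using that by (simp add: field_simps)
    also have "\<dots> \<le> exp y" by (rule exp_ge_add_one_self)
    finally show ?thesis by simp
  qed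
  then show ?thesis using that by (simp add: exp_minus field_simps)
qed

lemma summable_Suc_powr_three_halves: "summable (\<lambda>n. real (Suc n) powr (-3/2))"
  by (subst summable_Suc_iff) (simp add: summable_real_powr_iff)

lemma has_bochner_integral_exp_minus:
  fixes c :: real
  assumes "c > 0"
  shows "has_bochner_integral lborel (\<lambda>s. indicator {0..} s *\<^sub>R exp (- (c * s))) (1 / c)"
proof (rule has_bochner_integral_nn_integral)
  have "(\<integral>\<^sup>+ x. ennreal (exp (- (c * x))) * indicator {0..} x \<partial>lborel) = ennreal (0 - (- exp (- (c * 0)) / c))"
  proof (rule nn_integral_FTC_atLeast)
    show "((\<lambda>s. - exp (- (c * s)) / c) has_real_derivative exp (- (c * x))) (at x)" for x
      using assms by (auto intro!: derivative_eq_intros)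
    have "filterlim (\<lambda>s. - (c * s)) at_bot at_top"
      using assms by (intro filterlim_compose[OF filterlim_uminus_at_bot_at_top]
        filterlim_tendsto_pos_mult_at_top[OF tendsto_const] filterlim_ident)
    from filterlim_compose[OF exp_at_bot this]
    have "((\<lambda>s. - exp (- (c * s)) / c) \<longlongrightarrow> - 0 / c) at_top"
      using assms by (intro tendsto_intros) auto
    then show "((\<lambda>s. - exp (- (c * s)) / c) \<longlongrightarrow> 0) at_top" by simp
  qed auto
  moreover have "ennreal (indicator {0..} x *\<^sub>R exp (- (c * x))) = ennreal (exp (- (c * x))) * indicator {0..} x" for x
    by (auto simp: indicator_def)
  ultimately show "(\<integral>\<^sup>+ x. ennreal (indicator {0..} x *\<^sub>R exp (- (c * x))) \<partial>lborel) = ennreal (1 / c)"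
    by simp
qed (use assms in auto)

lemma exp_dominated:
  fixes h :: "real \<Rightarrow> complex"
  assumes c: "c > 0" and cont: "continuous_on {0<..} h"
    and bound: "\<And>s. s > 0 \<Longrightarrow> norm (h s) \<le> B * exp (- (c * s))"
  shows "set_integrable lborel {0<..} h"
    and "(LBINT s. norm (indicator {0<..} s *\<^sub>R h s)) \<le> B / c"
proof -
  have B: "B \<ge> 0"
    using bound[of 1] by (smt (verit) norm_ge_zero exp_gt_zero mult_neg_pos)
  have meas: "(\<lambda>s. indicator {0<..} s *\<^sub>R h s) \<in> borel_measurable lborel"
    using borel_measurable_continuous_on_indicator[OF _ cont] by simp
  note E = has_bochner_integral_mult_right[OF has_bochner_integral_exp_minus[OF c], of B]
  have le: "norm (indicator {0<..} s *\<^sub>R h s) \<le> B * (indicator {0..} s *\<^sub>R exp (- (c * s)))" for s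
    using bound[of s] B by (auto simp: indicator_def)
  have le': "norm (indicator {0<..} s *\<^sub>R h s) \<le> norm (B * (indicator {0..} s *\<^sub>R exp (- (c * s))))" for s
    using order_trans[OF le abs_ge_self] by simp
  have "integrable lborel (\<lambda>s. indicator {0<..} s *\<^sub>R h s)"
    by (rule Bochner_Integration.integrable_bound[OF integrable.intros[OF E] meas]) (use le' in auto)
  then show *: "set_integrable lborel {0<..} h"
    by (simp add: set_integrable_def)
  have "(LBINT s. norm (indicator {0<..} s *\<^sub>R h s)) \<le> (LBINT s. B * (indicator {0..} s *\<^sub>R exp (- (c * s))))"
    using * by (intro integral_mono integrable_norm integrable.intros[OF E] le) (simp add: set_integrable_def)
  also have "\<dots> = B / c"
    using has_bochner_integral_integral_eq[OF E] by simp
  finally show "(LBINT s. norm (indicator {0<..} s *\<^sub>R h s)) \<le> B / c" .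
qed

text \<open>The rate \<open>c n\<close> may depend on n because in the series F the amplitudes
  \<open>B n\<close> are only of order 1 / n; it is the L1 norm, at most \<open>B n / c n\<close>,
  that is summable.\<close>

lemma exp_dominated_suminf:
  fixes f :: "nat \<Rightarrow> real \<Rightarrow> complex"
  assumes c: "\<And>n. c n > 0" and cont: "\<And>n. continuous_on {0<..} (f n)"
    and bound: "\<And>n s. s > 0 \<Longrightarrow> norm (f n s) \<le> B n * exp (- (c n * s))"
    and summ: "summable (\<lambda>n. B n / c n)"
    and summ': "\<And>s. s > 0 \<Longrightarrow> summable (\<lambda>n. norm (f n s))"
    and eq: "\<And>s. s > 0 \<Longrightarrow> h s = (\<Sum>n. f n s)"
  shows "set_integrable lborel {0<..} h"
    and "(\<lambda>n. LBINT s:{0<..}. f n s) sums (LBINT s:{0<..}. h s)"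
proof -
  note D = exp_dominated[OF c cont bound]
  have 1: "integrable lborel (\<lambda>s. indicator {0<..} s *\<^sub>R f n s)" for n
    using D(1)[of n] by (simp add: set_integrable_def)
  have 2: "AE s in lborel. summable (\<lambda>n. norm (indicator {0<..} s *\<^sub>R f n s))"
    by (intro AE_I2) (use summ' in \<open>auto simp: indicator_def\<close>)
  have 3: "summable (\<lambda>n. LBINT s. norm (indicator {0<..} s *\<^sub>R f n s))"
    by (rule summable_comparison_test'[OF summ, of 0]) (use D(2) in simp)
  have 4: "(\<lambda>s. \<Sum>n. indicator {0<..} s *\<^sub>R f n s) = (\<lambda>s. indicator {0<..} s *\<^sub>R h s)"
    by (auto simp: indicator_def eq)
  show "set_integrable lborel {0<..} h"
    using integrable_suminf[OF 1 2 3] by (simp add: set_integrable_def 4)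
  show "(\<lambda>n. LBINT s:{0<..}. f n s) sums (LBINT s:{0<..}. h s)"
    using sums_integral[OF 1 2 3] by (simp add: set_lebesgue_integral_def 4)
qed

lemma ray_integral_primitive:
  fixes f \<Phi> :: "complex \<Rightarrow> complex" and a b :: real
  assumes \<Phi>: "\<And>z. z \<in> S \<Longrightarrow> (\<Phi> has_field_derivative f z) (at z)" and f: "continuous_on S f"
    and ab: "a \<le> b" and S: "\<And>s. a \<le> s \<Longrightarrow> s \<le> b \<Longrightarrow> u * of_real s \<in> S"
  shows "(LBINT s=a..b. f (u * of_real s) * u) = \<Phi> (u * of_real b) - \<Phi> (u * of_real a)"
proof (rule interval_integral_FTC_finite)
  show "continuous_on {min a b..max a b} (\<lambda>s. f (u * of_real s) * u)"
    using S ab by (intro continuous_intros continuous_on_compose2[OF f]) auto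
  fix s assume s: "min a b \<le> s" "s \<le> max a b"
  have "((\<lambda>z. \<Phi> (u * z)) has_field_derivative f (u * of_real s) * u) (at (of_real s))"
    using S[of s] s ab by (intro DERIV_chain2[where g = "\<lambda>z. u * z"] \<Phi>) (auto intro!: derivative_eq_intros)
  from has_vector_derivative_real_field[OF this]
  show "((\<lambda>s. \<Phi> (u * of_real s)) has_vector_derivative f (u * of_real s) * u) (at s within {min a b..max a b})" .
qed

text \<open>Every point of \<open>U\<close> off the upward slit at \<open>c\<close> is visible from a point below the slit.\<close>

lemma slit_primitive:
  fixes U :: "complex set" and c :: real
  defines "S \<equiv> U - {z. Re z = c \<and> Im z \<ge> 0}"
  assumes U: "convex U" "open U" and a: "a \<in> U" "Re a = c" "Im a < 0"
    and f: "f holomorphic_on S"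
  obtains \<Phi> where "\<And>z. z \<in> S \<Longrightarrow> (\<Phi> has_field_derivative f z) (at z)"
proof -
  have "closed ({z. Re z = c} \<inter> {z. Im z \<ge> 0})"
    by (intro closed_Int closed_halfspace_Im_ge) (auto intro!: closed_Collect_eq continuous_intros)
  then have "closed {z. Re z = c \<and> Im z \<ge> 0}" by (simp add: Collect_conj_eq)
  then have op: "open S" unfolding S_def using U by (intro open_Diff)
  have seg: "closed_segment a z \<subseteq> S" if z: "z \<in> S" for z
  proof
    fix x assume x: "x \<in> closed_segment a z"
    then have xU: "x \<in> U" using closed_segment_subset[OF a(1) _ U(1), of z] z by (auto simp: S_def)
    from x obtain t where t: "0 \<le> t" "t \<le> 1" "x = (1 - t) *\<^sub>R a + t *\<^sub>R z"
      by (auto simp: in_segment)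
    have False if "Re x = c" "Im x \<ge> 0"
    proof -
      have Im: "Im x = (1 - t) * Im a + t * Im z" and Re: "Re x = (1 - t) * c + t * Re z"
        using t a by auto
      \<comment> \<open>A segment from \<open>a\<close> that meets the slit away from
        \<open>a\<close> is vertical, so its other end also lies on the line Re = c, and hence below
        the slit.\<close>
      have "t * (Re z - c) = 0" using Re that by (auto simp: algebra_simps)
      moreover have "t \<noteq> 0" using Im that a by auto
      ultimately have "Im z < 0" using z by (auto simp: S_def)
      then have "t * Im z < 0" using \<open>t \<noteq> 0\<close> t by (simp add: mult_pos_neg)
      moreover have "(1 - t) * Im a \<le> 0" using t a by (simp add: mult_nonneg_nonpos)
      ultimately show False using Im that by linarith
    qed
    then show "x \<in> S" using xU by (auto simp: S_def)
  qed
  moreover have "a \<in> S" using a by (auto simp: S_def)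
  ultimately have "starlike S" by (auto simp: starlike_def)
  then obtain \<Phi> where "\<forall>z\<in>S. (\<Phi> has_field_derivative f z) (at z)"
    using holomorphic_starlike_primitive[OF holomorphic_on_imp_continuous_on[OF f] _ op finite.emptyI]
      holomorphic_on_imp_differentiable_at[OF f op] by blast
  then show ?thesis using that by blast
qed

section \<open>Geometry of the lower semicircles\<close>

lemma lower_semicircle_points:
  assumes "z \<in> path_image (part_circlepath (of_real c) r pi (2 * pi))" "r > 0"
  shows "norm (z - of_real c) = r" "Im z \<le> 0"
proof -
  obtain x where x: "pi \<le> x" "x \<le> 2 * pi" "z = of_real c + of_real r * exp (\<i> * of_real x)"
    using assms by (auto simp: path_image_part_circlepath)
  show "norm (z - of_real c) = r" using x assms by (simp add: norm_mult)
  have "sin x \<le> 0" using x sin_le_zero[of x] by (cases "x = 2 * pi") auto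
  then show "Im z \<le> 0" using x assms by (simp add: Im_exp mult_nonneg_nonpos)
qed

text \<open>A common point with the slit could only be the centre, which is at distance 0 and not r.
  Thus an indentation below a pole stays in the domain of \<open>slit_primitive\<close>.\<close>

lemma lower_semicircle_avoids_slit:
  assumes "z \<in> path_image (part_circlepath (of_real c) r pi (2 * pi))" "r > 0"
  shows "\<bar>Re z - c\<bar> \<le> r" "\<not> (Re z = c \<and> Im z \<ge> 0)"
proof -
  note P = lower_semicircle_points[OF assms]
  show "\<bar>Re z - c\<bar> \<le> r" using abs_Re_le_cmod[of "z - of_real c"] P by simp
  show "\<not> (Re z = c \<and> Im z \<ge> 0)"
  proof
    assume "Re z = c \<and> Im z \<ge> 0"
    then have "z = of_real c" using P by (auto simp: complex_eq_iff)
    then show False using P assms by simp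
  qed
qed

lemma semicircle_endpoints:
  "pathstart (part_circlepath z r pi (2 * pi)) = z - of_real r"
  "pathfinish (part_circlepath z r pi (2 * pi)) = z + of_real r"
  by (simp_all add: exp_pi_i' exp_two_pi_i' mult.commute)

section \<open>The cotangent away from its poles and near 0\<close>

text \<open>With s = sin^2 (Re z) and E = sinh^2 (Im z), the squared norms of cos z and sin z are 1
  - s + E and s + E. The bound does not depend on Im z, as needed on vertical segments of growing
  length.\<close>

lemma norm_cot_le:
  fixes z :: complex
  assumes "sin (Re z) \<noteq> 0"
  shows "norm (cot z) \<le> 1 / \<bar>sin (Re z)\<bar>"
proof -
  define s where "s = (sin (Re z))\<^sup>2"
  define E where "E = (exp (Im z) - inverse (exp (Im z)))\<^sup>2 / 4"
  have s: "0 < s" "s \<le> 1" using assms by (auto simp: s_def abs_square_le_1)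
  have E: "E \<ge> 0" by (simp add: E_def)
  have c: "norm (cos z) ^ 2 = 1 - s + E"
    unfolding norm_cos_squared E_def s_def by (simp add: cos_squared_eq)
  have sn: "norm (sin z) ^ 2 = s + E"
  proof -
    have "norm (sin z) ^ 2 = norm (cos (pi / 2 - z)) ^ 2" by (simp add: sin_cos_eq)
    also have "\<dots> = s + (exp (- Im z) - inverse (exp (- Im z)))\<^sup>2 / 4"
      unfolding norm_cos_squared by (simp add: s_def sin_cos_eq)
    also have "(exp (- Im z) - inverse (exp (- Im z)))\<^sup>2 = (exp (Im z) - inverse (exp (Im z)))\<^sup>2"
      by (simp add: exp_minus power2_commute)
    finally show ?thesis by (simp add: E_def)
  qed
  have "(norm (cot z) * \<bar>sin (Re z)\<bar>)\<^sup>2 = (1 - s + E) * s / (s + E)"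
    by (simp add: cot_def norm_divide power_mult_distrib power_divide c sn s_def)
  also have "\<dots> \<le> 1"
  proof -
    have "(1 - s + E) * s \<le> 1 * s + E * 1"
      using s E mult_left_le[of s E] mult_nonneg_nonneg[of s s] by (simp add: algebra_simps add_increasing2)
    then show ?thesis using s E by simp
  qed
  finally have "norm (cot z) * \<bar>sin (Re z)\<bar> \<le> 1"
    by (simp add: abs_square_le_1 abs_mult)
  then show ?thesis using assms by (simp add: field_simps)
qed

lemma real_multiple_2pi: "n = 0" if "\<bar>2 * pi * real_of_int n\<bar> < 2 * pi"
  using that by (simp add: abs_mult)

text \<open>The \<open>Digamma\<close> form, valid in a punctured neighbourhood of 0, is continuous
  at 0, where its two values cancel.\<close>

lemma tendsto_cot_minus_inverse: "((\<lambda>t :: complex. cot (t / 2) - 2 / t) \<longlongrightarrow> 0) (at 0)"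
proof (rule Lim_transform_eventually)
  have "((\<lambda>t :: complex. (Digamma (1 - t / (2 * pi)) - Digamma (1 + t / (2 * pi))) / complex_of_real pi)
      \<longlongrightarrow> (Digamma (1 - (0 :: complex) / (2 * pi)) - Digamma (1 + (0 :: complex) / (2 * pi))) / complex_of_real pi) (at 0)"
    by (intro tendsto_divide tendsto_diff tendsto_add tendsto_Polygamma tendsto_const tendsto_ident_at) auto
  then show "((\<lambda>t :: complex. (Digamma (1 - t / (2 * pi)) - Digamma (1 + t / (2 * pi))) / complex_of_real pi) \<longlongrightarrow> 0) (at 0)"
    by simp
  have "eventually (\<lambda>t. t \<in> ball 0 (2 * pi) - {0}) (at (0 :: complex))"
    by (rule eventually_at_in_open) auto
  then show "\<forall>\<^sub>F t :: complex in at 0. (Digamma (1 - t / (2 * pi)) - Digamma (1 + t / (2 * pi))) / complex_of_real pi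
      = cot (t / 2) - 2 / t"
  proof eventually_elim
    case (elim t)
    have "t / (2 * pi) \<notin> \<int>"
    proof
      assume "t / (2 * pi) \<in> \<int>"
      then obtain n where n: "t / (2 * pi) = of_int n" by (elim Ints_cases)
      then have "t = of_real (2 * pi * of_int n)" by (simp add: field_simps)
      then show False using elim real_multiple_2pi[of n] by (auto simp: norm_mult abs_mult)
    qed
    from cot_minus_inverse_eq_Digamma[OF this] elim show ?case
      by (simp add: field_simps)
  qed
qed

section \<open>The indented path, its truncations, and limits of primitives\<close>

text \<open>Left end of the n-th indentation. These abscissas keep the same distance r from the
  poles, so the cotangent is bounded on the verticals through them uniformly in n.\<close>

definition node :: "real \<Rightarrow> nat \<Rightarrow> real" where "node r n = 2 * pi * real n - r"

lemma ell_minus_ends: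
  "pathstart (ell_minus r N) = 0" "pathfinish (ell_minus r N) = of_real (node r (Suc N))"
  by (induction N) (simp_all add: node_def)

lemma valid_path_ell_minus: "valid_path (ell_minus r N)"
proof (induction N)
  case (Suc N)
  have "pathfinish (ell_minus r N) = of_real (2 * pi * real (Suc N)) - of_real r"
    by (simp add: ell_minus_ends node_def)
  then show ?case using Suc
    by (simp only: ell_minus.simps)
       (intro valid_path_join valid_path_part_circlepath valid_path_linepath;
        simp add: semicircle_endpoints del: pathstart_part_circlepath pathfinish_part_circlepath)
qed (simp only: ell_minus.simps valid_path_linepath)

lemma convex_strip: "convex {z. a < Re z \<and> Re z < b}"
  by (simp add: Collect_conj_eq convex_Int convex_halfspace_Re_gt convex_halfspace_Re_lt)

lemma open_strip: "open {z. a < Re z \<and> Re z < b}"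
  by (simp add: Collect_conj_eq open_Int open_halfspace_Re_gt open_halfspace_Re_lt)

lemma node_less: "0 < r \<Longrightarrow> r < 1 \<Longrightarrow> 1 < node r (Suc n)" "node r n < node r (Suc n)"
proof -
  have "2 * pi * real (Suc n) \<ge> 2 * pi * 1" by (intro mult_left_mono) auto
  then show "0 < r \<Longrightarrow> r < 1 \<Longrightarrow> 1 < node r (Suc n)" using pi_gt3 unfolding node_def by linarith
  show "node r n < node r (Suc n)" by (simp add: node_def algebra_simps)
qed

text \<open>\<open>S\<close> may omit 0, as a cone does, so \<Phi> has no value to insert at the
  lower end; integrability up to 0 supplies its limit instead.\<close>

lemma tendsto_primitive_at_right_0:
  fixes f \<Phi> :: "complex \<Rightarrow> complex"
  assumes \<Phi>: "\<And>z. z \<in> S \<Longrightarrow> (\<Phi> has_field_derivative f z) (at z)" and f: "continuous_on S f"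
    and b: "b > 0" and S: "\<And>s. 0 < s \<Longrightarrow> s \<le> b \<Longrightarrow> u * of_real s \<in> S"
    and int: "set_integrable lborel {0<..b} (\<lambda>s. f (u * of_real s) * u)"
  shows "((\<lambda>s. \<Phi> (u * of_real s)) \<longlongrightarrow> \<Phi> (u * of_real b) - (LBINT s:{0<..b}. f (u * of_real s) * u)) (at_right 0)"
proof (rule Lim_transform_eventually)
  have "((\<lambda>a. LBINT s:{a..b}. f (u * of_real s) * u) \<longlongrightarrow> (LBINT s:{0<..b}. f (u * of_real s) * u)) (at_right 0)"
    by (rule tendsto_set_lebesgue_integral_at_right) (use b int in auto)
  then show "((\<lambda>a. \<Phi> (u * of_real b) - (LBINT s:{a..b}. f (u * of_real s) * u)) \<longlongrightarrow>
      \<Phi> (u * of_real b) - (LBINT s:{0<..b}. f (u * of_real s) * u)) (at_right 0)"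
    by (intro tendsto_intros)
  have "eventually (\<lambda>a. a \<in> {0<..<b}) (at_right 0)"
    using b by (rule eventually_at_right_real)
  then show "\<forall>\<^sub>F a in at_right 0. \<Phi> (u * of_real b) - (LBINT s:{a..b}. f (u * of_real s) * u) = \<Phi> (u * of_real a)"
  proof eventually_elim
    case (elim a)
    then have "(LBINT s=a..b. f (u * of_real s) * u) = \<Phi> (u * of_real b) - \<Phi> (u * of_real a)"
      using S by (intro ray_integral_primitive[OF \<Phi> f]) auto
    moreover have "(LBINT s=a..b. f (u * of_real s) * u) = (LBINT s:{a..b}. f (u * of_real s) * u)"
      using elim by (intro interval_integral_Icc) auto
    ultimately show ?case by (simp only: diff_diff_eq2 add_diff_cancel_left')
  qed
qed

lemma tendsto_primitive_at_top:
  fixes f \<Phi> :: "complex \<Rightarrow> complex"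
  assumes \<Phi>: "\<And>z. z \<in> S \<Longrightarrow> (\<Phi> has_field_derivative f z) (at z)" and f: "continuous_on S f"
    and S: "\<And>s. b \<le> s \<Longrightarrow> u * of_real s \<in> S"
    and int: "set_integrable lborel {b..} (\<lambda>s. f (u * of_real s) * u)"
  shows "((\<lambda>s. \<Phi> (u * of_real s)) \<longlongrightarrow> \<Phi> (u * of_real b) + (LBINT s:{b..}. f (u * of_real s) * u)) at_top"
proof (rule Lim_transform_eventually)
  have "((\<lambda>a. LBINT s:{b..a}. f (u * of_real s) * u) \<longlongrightarrow> (LBINT s:{b..}. f (u * of_real s) * u)) at_top"
    by (rule tendsto_set_lebesgue_integral_at_top) (use int in auto)
  then show "((\<lambda>a. \<Phi> (u * of_real b) + (LBINT s:{b..a}. f (u * of_real s) * u)) \<longlongrightarrow>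
      \<Phi> (u * of_real b) + (LBINT s:{b..}. f (u * of_real s) * u)) at_top"
    by (intro tendsto_intros)
  show "\<forall>\<^sub>F a in at_top. \<Phi> (u * of_real b) + (LBINT s:{b..a}. f (u * of_real s) * u) = \<Phi> (u * of_real a)"
    using eventually_ge_at_top[of b]
  proof eventually_elim
    case (elim a)
    then have "(LBINT s=b..a. f (u * of_real s) * u) = \<Phi> (u * of_real a) - \<Phi> (u * of_real b)"
      using S by (intro ray_integral_primitive[OF \<Phi> f]) auto
    moreover have "(LBINT s=b..a. f (u * of_real s) * u) = (LBINT s:{b..a}. f (u * of_real s) * u)"
      using elim by (intro interval_integral_Icc) auto
    ultimately show ?case by (simp only: add_diff_cancel_left' add_diff_eq)
  qed
qed

text \<open>On a circle about c, dt / (t - c) is \<open>\<i>\<close> times the increment of the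
  angle. Half a turn gives half a residue, for every radius.\<close>

lemma part_circlepath_simple_pole:
  fixes k :: complex
  assumes "\<epsilon> > 0"
  shows "((\<lambda>t. k / (t - c)) has_contour_integral (\<i> * pi * k)) (part_circlepath c \<epsilon> pi (2 * pi))"
proof -
  have "((\<lambda>t. \<i> * k) has_integral (2 * pi - pi) *\<^sub>R (\<i> * k)) {pi..2 * pi}"
    by (rule has_integral_const_real[THEN has_integral_eq_rhs]) simp
  then show ?thesis using assms
    by (subst has_contour_integral_part_circlepath_iff)
       (auto simp: scaleR_conv_of_real mult_ac field_simps)
qed

lemma sin_node: "\<bar>sin (node r (Suc N) / 2)\<bar> = \<bar>sin (r / 2)\<bar>"
proof -
  have "node r (Suc N) / 2 = real (Suc N) * pi - r / 2" by (simp add: node_def field_simps)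
  then show ?thesis
    by (simp only: sin_diff sin_npi cos_npi) (simp add: abs_mult power_abs)
qed

lemma filterlim_node: "filterlim (\<lambda>N. node r (Suc N)) at_top sequentially"
proof -
  have "filterlim (\<lambda>N. - r + 2 * pi * real (Suc N)) at_top sequentially"
    by (intro filterlim_tendsto_add_at_top[OF tendsto_const] filterlim_tendsto_pos_mult_at_top[OF tendsto_const]
        filterlim_compose[OF filterlim_real_sequentially filterlim_Suc]) auto
  then show ?thesis by (simp add: node_def)
qed

section \<open>Tools for the principal value and for double series\<close>

lemma has_PV_integral_unique:
  assumes "has_PV_integral f I A c" "has_PV_integral f J A c"
  shows "I = J"
  using assms tendsto_unique[OF trivial_limit_at_right_real] unfolding has_PV_integral_def by blast

lemma norm_one_minus_square_ge:
  assumes "Re z = x" "x > 0"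
  shows "\<bar>1 - x\<bar> * (1 + x) \<le> norm (1 - z\<^sup>2)"
proof -
  have "\<bar>1 - x\<bar> * (1 + x) \<le> norm (1 - z) * norm (1 + z)"
    using assms abs_Re_le_cmod[of "1 - z"] complex_Re_le_cmod[of "1 + z"] by (intro mult_mono) auto
  also have "\<dots> = norm (1 - z\<^sup>2)" by (simp add: power2_eq_square algebra_simps flip: norm_mult)
  finally show ?thesis .
qed

lemma abs_summable_on_geometric_product:
  fixes q :: real
  assumes "0 \<le> q" "q < 1"
  shows "(\<lambda>z. norm (case z of (m, n) \<Rightarrow> q ^ m * q ^ n)) summable_on (UNIV \<times> UNIV :: (nat \<times> nat) set)"
proof -
  have g: "(\<lambda>n. q ^ n) summable_on UNIV"
    using assms by (intro norm_summable_imp_summable_on) (simp add: norm_power)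
  show ?thesis
    unfolding Infinite_Sum.abs_summable_on_Sigma_iff
    using assms g by (auto simp: abs_mult infsum_cmult_right' intro!: summable_on_cmult_right summable_on_cmult_left infsum_nonneg)
qed

text \<open>Absolute summability over pairs gives one unordered sum, to which both iterated sums are
  equal.\<close>

lemma double_series_swap:
  fixes a :: "nat \<Rightarrow> nat \<Rightarrow> complex"
  assumes abs: "(\<lambda>z. norm (case z of (m, n) \<Rightarrow> a m n)) summable_on (UNIV \<times> UNIV)"
    and row: "\<And>m. a m sums r m" and col: "\<And>n. (\<lambda>m. a m n) sums c n"
  shows "summable r" "summable c" "suminf r = suminf c"
proof -
  have s: "summable (\<lambda>n. norm (a m n))" "summable (\<lambda>m. norm (a m n))" for m n
  proof -
    show "summable (\<lambda>n. norm (a m n))"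
      using abs unfolding Infinite_Sum.abs_summable_on_Sigma_iff by (auto dest: summable_on_imp_summable)
    have "(\<lambda>(m, n). norm (a m n)) summable_on (UNIV \<times> UNIV)" using abs by (simp add: case_prod_unfold)
    then have "(\<lambda>(n, m). norm (a m n)) summable_on (UNIV \<times> UNIV)"
      by (subst summable_on_swap) (simp add: case_prod_unfold)
    from summable_on_SigmaD1[OF this, of n] show "summable (\<lambda>m. norm (a m n))"
      by (auto dest: summable_on_imp_summable)
  qed
  obtain S where S: "((\<lambda>(m, n). a m n) has_sum S) (UNIV \<times> UNIV)"
    using abs_summable_summable[OF abs] by (auto simp: summable_on_def)
  have "(r has_sum S) UNIV"
    by (rule has_sum_SigmaD[OF S]) (use norm_summable_imp_has_sum[OF s(1) row] in auto)
  then have r: "r sums S" by (rule has_sum_imp_sums)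
  have "((\<lambda>(n, m). a m n) has_sum S) (UNIV \<times> UNIV)"
    using S by (subst has_sum_swap) (simp add: case_prod_unfold)
  then have "(c has_sum S) UNIV"
    by (rule has_sum_SigmaD) (use norm_summable_imp_has_sum[OF s(2) col] in auto)
  then have c: "c sums S" by (rule has_sum_imp_sums)
  show "summable r" "summable c" "suminf r = suminf c"
    using r c by (auto simp: sums_iff)
qed

section \<open>The kernel in a cone\<close>

locale bose_sine =
  fixes \<alpha> \<nu> :: real
  assumes \<alpha>_pos: "\<alpha> > 0"
begin

definition g :: "complex \<Rightarrow> complex" where
  "g t = sin (of_real \<nu> * t) / (exp (t / of_real \<alpha>) - 1)"

text \<open>The second bound lets the decay of \<open>1 / (e\<^bsup>t/\<alpha>\<^esup> - 1)\<close> beat the growth of \<open>sin (\<nu> t)\<close> in the cone;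
  the first one keeps the ray up to abscissa \<open>2 \<pi>\<close> within \<open>\<bar>Im t\<bar> < 2 \<pi> \<alpha>\<close>, where \<open>g\<close> has no pole.\<close>

definition K :: real where "K = min \<alpha> (1 / (4 * \<alpha> * (\<bar>\<nu>\<bar> + 1)))"

definition cone :: "complex set" where "cone = {t. Re t > 0 \<and> \<bar>Im t\<bar> < K * Re t}"

text \<open>Constant of \<open>g_bound\<close>: norm t is at most (1 + K) Re t in the cone, and
  \<alpha> comes from the factor Re t / \<alpha> in the lower bound for the denominator.\<close>

definition C :: real where "C = \<bar>\<nu>\<bar> * \<alpha> * (1 + K)"

definition F :: "complex \<Rightarrow> complex" where
  "F t = (\<Sum>n. g (of_real (2 * pi * real (Suc n)) * t) / of_nat (Suc n))"

text \<open>The summand 1 in the definition of \<open>K\<close> is what secures this for \<nu> =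
  0.\<close>

lemma K_pos: "K > 0"
  using \<alpha>_pos by (auto simp: K_def)

lemma K_le: "K \<le> \<alpha>" "\<bar>\<nu>\<bar> * K \<le> 1 / (4 * \<alpha>)"
proof -
  show "K \<le> \<alpha>" by (simp add: K_def)
  have "\<bar>\<nu>\<bar> * K \<le> \<bar>\<nu>\<bar> * (1 / (4 * \<alpha> * (\<bar>\<nu>\<bar> + 1)))"
    by (intro mult_left_mono) (auto simp: K_def)
  also have "\<dots> \<le> 1 / (4 * \<alpha>)"
  proof -
    have "\<bar>\<nu>\<bar> * (1 / (4 * \<alpha> * (\<bar>\<nu>\<bar> + 1))) = (\<bar>\<nu>\<bar> / (\<bar>\<nu>\<bar> + 1)) * (1 / (4 * \<alpha>))"
      by simp
    also have "\<dots> \<le> 1 * (1 / (4 * \<alpha>))" using \<alpha>_pos by (intro mult_right_mono) auto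
    finally show ?thesis by simp
  qed
  finally show "\<bar>\<nu>\<bar> * K \<le> 1 / (4 * \<alpha>)" .
qed

lemma C_nonneg: "C \<ge> 0"
  using \<alpha>_pos K_pos by (simp add: C_def)

text \<open>With x = Re t, the denominator is at least exp (x / (2 \<alpha>)) x / \<alpha> and the
  sine costs at most exp (x / (4 \<alpha>)) times a multiple of x. The factors x cancel, so the
  bound holds down to 0.\<close>

lemma g_bound:
  assumes "t \<in> cone"
  shows "norm (g t) \<le> C * exp (- (Re t / (4 * \<alpha>)))"
proof -
  define x where "x = Re t"
  have x: "x > 0" and Im: "\<bar>Im t\<bar> \<le> K * x" using assms by (auto simp: cone_def x_def)
  have "norm t \<le> x + \<bar>Im t\<bar>" using cmod_le[of t] x by (simp add: x_def)
  also have "\<dots> \<le> (1 + K) * x" using Im by (simp add: algebra_simps)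
  finally have nt: "norm t \<le> (1 + K) * x" .
  have "\<bar>\<nu>\<bar> * \<bar>Im t\<bar> \<le> \<bar>\<nu>\<bar> * (K * x)" using Im by (intro mult_left_mono) auto
  also have "\<dots> = (\<bar>\<nu>\<bar> * K) * x" by simp
  also have "\<dots> \<le> 1 / (4 * \<alpha>) * x" using K_le(2) x by (intro mult_right_mono) auto
  finally have Im': "\<bar>\<nu>\<bar> * \<bar>Im t\<bar> \<le> x / (4 * \<alpha>)" by simp
  have "norm (sin (of_real \<nu> * t)) \<le> norm (of_real \<nu> * t) * exp \<bar>Im (of_real \<nu> * t)\<bar>"
    by (rule norm_sin_le)
  also have "\<dots> \<le> (\<bar>\<nu>\<bar> * ((1 + K) * x)) * exp (x / (4 * \<alpha>))"
    using nt Im' x K_pos by (intro mult_mono) (auto simp: norm_mult abs_mult intro!: mult_left_mono)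
  finally have num: "norm (sin (of_real \<nu> * t)) \<le> (\<bar>\<nu>\<bar> * ((1 + K) * x)) * exp (x / (4 * \<alpha>))" .
  have "exp (x / (2 * \<alpha>)) * (x / \<alpha>) \<le> exp (x / \<alpha>) - 1"
    using exp_minus_1_ge[of "x / (2 * \<alpha>)"] x \<alpha>_pos by simp
  also have "\<dots> = norm (exp (t / of_real \<alpha>)) - norm (1 :: complex)"
    by (simp add: x_def)
  also have "\<dots> \<le> norm (exp (t / of_real \<alpha>) - 1)"
    by (rule norm_triangle_ineq2)
  finally have den: "exp (x / (2 * \<alpha>)) * (x / \<alpha>) \<le> norm (exp (t / of_real \<alpha>) - 1)" .
  have "norm (g t) \<le> ((\<bar>\<nu>\<bar> * ((1 + K) * x)) * exp (x / (4 * \<alpha>))) / (exp (x / (2 * \<alpha>)) * (x / \<alpha>))"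
    unfolding g_def norm_divide using num den x \<alpha>_pos K_pos by (intro frac_le) auto
  also have "\<dots> = C * (exp (x / (4 * \<alpha>)) / exp (x / (2 * \<alpha>)))"
    using x \<alpha>_pos by (simp add: C_def)
  also have "exp (x / (4 * \<alpha>)) / exp (x / (2 * \<alpha>)) = exp (- (x / (4 * \<alpha>)))"
    using \<alpha>_pos by (simp flip: exp_diff)
  finally show ?thesis by (simp add: x_def)
qed

lemma cone_scale: "t \<in> cone \<Longrightarrow> c > 0 \<Longrightarrow> of_real c * t \<in> cone"
  by (simp add: cone_def abs_mult)

lemma g_scaled_bound:
  assumes "t \<in> cone"
  shows "norm (g (of_real (2 * pi * real (Suc n)) * t) / of_nat (Suc n))
    \<le> C * exp (- (pi * real (Suc n) / (2 * \<alpha>) * Re t)) / real (Suc n)"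
proof -
  have "norm (g (of_real (2 * pi * real (Suc n)) * t)) \<le> C * exp (- (Re (of_real (2 * pi * real (Suc n)) * t) / (4 * \<alpha>)))"
    by (intro g_bound cone_scale assms) auto
  also have "Re (of_real (2 * pi * real (Suc n)) * t) / (4 * \<alpha>) = pi * real (Suc n) / (2 * \<alpha>) * Re t"
    using \<alpha>_pos by simp
  finally show ?thesis
    by (simp add: norm_divide divide_right_mono del: of_nat_Suc)
qed

definition S\<^sub>F :: real where "S\<^sub>F = C * sqrt (2 * \<alpha> / pi) * (\<Sum>n. real (Suc n) powr (-3/2))"

text \<open>Summable in n at the cost of 1 / sqrt (Re t). This singularity is weak enough for
  segments of length proportional to Re t.\<close>

lemma g_scaled_bound_powr:
  assumes "t \<in> cone"
  shows "norm (g (of_real (2 * pi * real (Suc n)) * t) / of_nat (Suc n))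
    \<le> C * sqrt (2 * \<alpha> / pi) / sqrt (Re t) * real (Suc n) powr (-3/2)"
proof -
  define m where "m = real (Suc n)"
  have m: "m > 0" by (simp add: m_def)
  have x: "Re t > 0" using assms by (simp add: cone_def)
  have "norm (g (of_real (2 * pi * real (Suc n)) * t) / of_nat (Suc n)) \<le> C * exp (- (pi * m / (2 * \<alpha>) * Re t)) / m"
    using g_scaled_bound[OF assms] by (simp add: m_def)
  also have "\<dots> \<le> C * (1 / sqrt (pi * m / (2 * \<alpha>) * Re t)) / m"
    using x m \<alpha>_pos C_nonneg
    by (intro divide_right_mono mult_left_mono exp_minus_le_inverse_sqrt) auto
  also have "\<dots> = C * sqrt (2 * \<alpha> / pi) / sqrt (Re t) * (1 / (sqrt m * m))"
    using x m \<alpha>_pos by (simp add: real_sqrt_mult real_sqrt_divide field_simps)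
  also have "1 / (sqrt m * m) = m powr (-3/2)"
  proof -
    have "sqrt m * m = m powr (1/2) * m powr 1" using m by (simp add: powr_half_sqrt)
    also have "\<dots> = m powr (3/2)" by (subst powr_add[symmetric]) simp
    finally show ?thesis using powr_minus_divide[of m "3/2"] by simp
  qed
  finally show ?thesis by (simp add: m_def)
qed

lemma F_summable:
  assumes "t \<in> cone"
  shows "summable (\<lambda>n. norm (g (of_real (2 * pi * real (Suc n)) * t) / of_nat (Suc n)))"
  by (rule summable_comparison_test'[OF summable_mult[OF summable_Suc_powr_three_halves]])
     (simp only: real_norm_def abs_norm_cancel, rule g_scaled_bound_powr[OF assms])

lemma F_bound:
  assumes "t \<in> cone"
  shows "norm (F t) \<le> S\<^sub>F / sqrt (Re t)"
proof -
  have "norm (F t) \<le> (\<Sum>n. norm (g (of_real (2 * pi * real (Suc n)) * t) / of_nat (Suc n)))"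
    unfolding F_def by (rule summable_norm[OF F_summable[OF assms]])
  also have "\<dots> \<le> (\<Sum>n. C * sqrt (2 * \<alpha> / pi) / sqrt (Re t) * real (Suc n) powr (-3/2))"
    by (intro suminf_le F_summable assms summable_mult summable_Suc_powr_three_halves g_scaled_bound_powr)
  also have "\<dots> = C * sqrt (2 * \<alpha> / pi) / sqrt (Re t) * (\<Sum>n. real (Suc n) powr (-3/2))"
    by (rule suminf_mult[OF summable_Suc_powr_three_halves])
  finally show ?thesis by (simp add: S\<^sub>F_def)
qed

lemma open_cone: "open cone"
  unfolding cone_def by (intro open_Collect_conj open_Collect_less continuous_intros)

lemma convex_cone: "convex cone"
proof (rule convexI)
  fix x y :: complex and u v :: real
  assume *: "x \<in> cone" "y \<in> cone" "0 \<le> u" "0 \<le> v" "u + v = 1"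
  have "u > 0 \<or> v > 0" using * by linarith
  then have p: "u * Re x + v * Re y > 0" using * by (auto simp: cone_def add_pos_nonneg add_nonneg_pos)
  have "\<bar>u * Im x + v * Im y\<bar> \<le> u * \<bar>Im x\<bar> + v * \<bar>Im y\<bar>"
    using * by (metis abs_mult abs_of_nonneg abs_triangle_ineq)
  also have "\<dots> < u * (K * Re x) + v * (K * Re y)"
  proof -
    have le: "u * \<bar>Im x\<bar> \<le> u * (K * Re x)" "v * \<bar>Im y\<bar> \<le> v * (K * Re y)"
      using * by (auto simp: cone_def intro!: mult_left_mono)
    have "u > 0 \<Longrightarrow> u * \<bar>Im x\<bar> < u * (K * Re x)" "v > 0 \<Longrightarrow> v * \<bar>Im y\<bar> < v * (K * Re y)"
      using * by (auto simp: cone_def)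
    with le \<open>u > 0 \<or> v > 0\<close> show ?thesis by linarith
  qed
  finally show "u *\<^sub>R x + v *\<^sub>R y \<in> cone" using p by (simp add: cone_def distrib_left mult.left_commute)
qed

text \<open>The zeros of exp (t / \<alpha>) - 1 are the multiples of 2 \<pi> \<alpha> on the
  imaginary axis.\<close>

lemma exp_divide_neq_1:
  assumes "t \<noteq> 0" "\<bar>Im t\<bar> < 2 * pi * \<alpha> \<or> Re t \<noteq> 0"
  shows "exp (t / of_real \<alpha>) \<noteq> 1"
proof
  assume "exp (t / of_real \<alpha>) = 1"
  then obtain n :: int where n: "Re (t / of_real \<alpha>) = 0" "Im (t / of_real \<alpha>) = of_int (2 * n) * pi"
    by (auto simp: exp_eq_1)
  then have r: "Re t = 0" and i: "Im t = of_int (2 * n) * pi * \<alpha>" using \<alpha>_pos by (auto simp: field_simps)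
  then have "\<bar>of_int n\<bar> * (2 * pi * \<alpha>) < 1 * (2 * pi * \<alpha>)" using assms \<alpha>_pos by (simp add: abs_mult mult_ac)
  then have "\<bar>real_of_int n\<bar> < 1" using \<alpha>_pos by (subst (asm) mult_less_cancel_right_pos) auto
  then have "n = 0" by linarith
  then show False using r i assms by (simp add: complex_eq_iff)
qed

lemma g_holomorphic: "g holomorphic_on {t. Re t > 0}"
proof -
  have "exp (t / of_real \<alpha>) - 1 \<noteq> 0" if "Re t > 0" for t
    using exp_divide_neq_1[of t] that by fastforce
  then show ?thesis unfolding g_def using \<alpha>_pos by (intro holomorphic_intros) auto
qed

text \<open>The majorant degenerates as Re t tends to 0, so the M-test is applied on closed balls
  that stay in a half-plane Re t > \<delta>.\<close>

lemma F_holomorphic: "F holomorphic_on cone"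
proof (rule holomorphic_uniform_sequence[OF open_cone, where f = "\<lambda>N t. \<Sum>n<N. g (of_real (2 * pi * real (Suc n)) * t) / of_nat (Suc n)"])
  show "(\<lambda>t. \<Sum>n<N. g (of_real (2 * pi * real (Suc n)) * t) / of_nat (Suc n)) holomorphic_on cone" for N
    by (intro holomorphic_intros holomorphic_on_compose_gen[OF _ g_holomorphic, unfolded o_def])
       (auto simp: cone_def zero_less_mult_iff simp del: of_nat_Suc)
  fix x assume x: "x \<in> cone"
  define \<delta> where "\<delta> = Re x / 2"
  have \<delta>: "\<delta> > 0" using x by (simp add: \<delta>_def cone_def)
  have "open (cone \<inter> {t. Re t > \<delta>})"
    by (intro open_Int open_cone open_halfspace_Re_gt)
  moreover have "x \<in> cone \<inter> {t. Re t > \<delta>}" using x by (auto simp: \<delta>_def cone_def)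
  ultimately obtain d where d: "d > 0" "cball x d \<subseteq> cone \<inter> {t. Re t > \<delta>}"
    by (meson open_contains_cball)
  have "uniform_limit (cball x d) (\<lambda>N t. \<Sum>n<N. g (of_real (2 * pi * real (Suc n)) * t) / of_nat (Suc n)) F sequentially"
    unfolding F_def
  proof (rule Weierstrass_m_test)
    show "summable (\<lambda>n. C * sqrt (2 * \<alpha> / pi) / sqrt \<delta> * real (Suc n) powr (-3/2))"
      by (intro summable_mult summable_Suc_powr_three_halves)
    fix n t assume "t \<in> cball x d"
    then have t: "t \<in> cone" "Re t > \<delta>" using d by auto
    have "norm (g (of_real (2 * pi * real (Suc n)) * t) / of_nat (Suc n))
        \<le> C * sqrt (2 * \<alpha> / pi) / sqrt (Re t) * real (Suc n) powr (-3/2)"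
      by (rule g_scaled_bound_powr[OF t(1)])
    also have "\<dots> \<le> C * sqrt (2 * \<alpha> / pi) / sqrt \<delta> * real (Suc n) powr (-3/2)"
      using t \<delta> C_nonneg \<alpha>_pos by (intro mult_right_mono divide_left_mono) auto
    finally show "norm (g (of_real (2 * pi * real (Suc n)) * t) / of_nat (Suc n))
        \<le> C * sqrt (2 * \<alpha> / pi) / sqrt \<delta> * real (Suc n) powr (-3/2)" .
  qed
  then show "\<exists>d>0. cball x d \<subseteq> cone \<and>
      uniform_limit (cball x d) (\<lambda>N t. \<Sum>n<N. g (of_real (2 * pi * real (Suc n)) * t) / of_nat (Suc n)) F sequentially"
    using d by auto
qed

lemma M_sin_term_eq_g:
  "complex_of_real (M_sin_term \<alpha> \<nu> t (Suc n)) = g (of_real (2 * pi * real (Suc n)) * of_real t) / of_nat (Suc n)"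
  by (simp add: M_sin_term_def g_def mult_ac flip: sin_of_real exp_of_real)

lemma of_real_in_cone: "t > 0 \<Longrightarrow> complex_of_real t \<in> cone"
  using K_pos by (simp add: cone_def)

lemma M_sin_summable: "summable (\<lambda>n. M_sin_term \<alpha> \<nu> t (Suc n))" if "t > 0"
  using summable_norm_cancel[OF F_summable[OF of_real_in_cone[OF that]]]
  unfolding M_sin_term_eq_g[symmetric] by (simp only: summable_complex_of_real)

lemma F_of_real: "F (of_real t) = of_real (\<Sum>n. M_sin_term \<alpha> \<nu> t (Suc n))" if "t > 0"
  unfolding F_def M_sin_term_eq_g[symmetric] by (rule suminf_of_real[OF M_sin_summable[OF that], symmetric])

section \<open>Exchanging sum and integral on the rotated ray\<close>

text \<open>Half the opening of the cone, on its lower side. With real part 1, the point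
  \<open>w * s\<close> lies vertically below \<open>s\<close>, so ray and axis are joined by
  vertical segments.\<close>

definition w :: complex where "w = Complex 1 (- (K / 2))"

definition c\<^sub>w :: real where "c\<^sub>w = min 1 (K / 2) / 2"

lemma c\<^sub>w_pos: "c\<^sub>w > 0" using K_pos by (simp add: c\<^sub>w_def)

text \<open>For s >= a / 2 the ray is at depth at least K a / 4; for s < a / 2 its abscissa is a / 2
  away from a. The constant \<open>c\<^sub>w\<close> is the smaller of the two ratios. The factor a
  + w s is harmless, its real part being at least a.\<close>

lemma norm_diff_square_ge:
  assumes "a > 0" "s \<ge> 0"
  shows "norm ((of_real a)\<^sup>2 - (w * of_real s)\<^sup>2) \<ge> c\<^sub>w * a\<^sup>2"
proof -
  have "c\<^sub>w * a \<le> norm (of_real a - w * of_real s)"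
  proof (cases "s \<ge> a / 2")
    case True
    have "c\<^sub>w * a \<le> (K / 2) / 2 * a" using assms by (intro mult_right_mono) (auto simp: c\<^sub>w_def)
    also have "\<dots> \<le> (K / 2) * s" using True K_pos by (simp add: field_simps)
    also have "\<dots> = Im (of_real a - w * of_real s)" by (simp add: w_def)
    also have "\<dots> \<le> norm (of_real a - w * of_real s)" by (rule order_trans[OF abs_ge_self abs_Im_le_cmod])
    finally show ?thesis .
  next
    case False
    have "c\<^sub>w * a \<le> 1 / 2 * a" using assms by (intro mult_right_mono) (auto simp: c\<^sub>w_def)
    also have "\<dots> \<le> Re (of_real a - w * of_real s)" using False by (simp add: w_def)
    also have "\<dots> \<le> norm (of_real a - w * of_real s)" by (rule complex_Re_le_cmod)
    finally show ?thesis .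
  qed
  moreover have "a \<le> norm (of_real a + w * of_real s)"
  proof -
    have "a \<le> Re (of_real a + w * of_real s)" using assms by (simp add: w_def)
    also have "\<dots> \<le> norm (of_real a + w * of_real s)" by (rule complex_Re_le_cmod)
    finally show ?thesis .
  qed
  ultimately have "(c\<^sub>w * a) * a \<le> norm (of_real a - w * of_real s) * norm (of_real a + w * of_real s)"
    using assms c\<^sub>w_pos by (intro mult_mono) auto
  also have "\<dots> = norm ((of_real a)\<^sup>2 - (w * of_real s)\<^sup>2)"
    by (simp add: power2_eq_square algebra_simps flip: norm_mult)
  finally show ?thesis by (simp add: power2_eq_square mult_ac)
qed

lemma ray_in_cone:
  assumes "Re u = 1" "\<bar>Im u\<bar> < K" "s > 0"
  shows "u * of_real s \<in> cone"
  using assms by (simp add: cone_def abs_mult)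

lemma w_simps: "Re w = 1" "Im w = - (K / 2)" "\<bar>Im w\<bar> < K"
  using K_pos by (auto simp: w_def)

lemma continuous_on_g_ray:
  assumes "Re u = 1" "m > 0"
  shows "continuous_on {0<..} (\<lambda>s. g (of_real m * (u * of_real s)))"
  by (intro continuous_on_compose2[OF holomorphic_on_imp_continuous_on[OF g_holomorphic]] continuous_intros)
     (use assms in auto)

text \<open>Here the decay rate grows like n, so \<open>B n / c n\<close> has order 1 / n^2. The
  case u = 1, \<phi> = 1 gives integrability of F on the axis; the case u = w serves the
  ray.\<close>

lemma F_ray_integral:
  assumes u: "Re u = 1" "\<bar>Im u\<bar> < K" and cont: "continuous_on {0<..} \<phi>"
    and bound: "\<And>s. s > 0 \<Longrightarrow> norm (\<phi> s) \<le> D"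
  shows "set_integrable lborel {0<..} (\<lambda>s. F (u * of_real s) * \<phi> s)"
    and "(\<lambda>n. LBINT s:{0<..}. g (of_real (2 * pi * real (Suc n)) * (u * of_real s)) / of_nat (Suc n) * \<phi> s)
        sums (LBINT s:{0<..}. F (u * of_real s) * \<phi> s)"
proof -
  have D: "D \<ge> 0" using order_trans[OF norm_ge_zero bound[of 1]] by simp
  define c where "c n = pi * real (Suc n) / (2 * \<alpha>)" for n
  define B where "B n = C / real (Suc n) * D" for n
  have c: "c n > 0" for n using \<alpha>_pos by (simp add: c_def)
  have cf: "continuous_on {0<..} (\<lambda>s. g (of_real (2 * pi * real (Suc n)) * (u * of_real s)) / of_nat (Suc n) * \<phi> s)" for n
    by (intro continuous_intros continuous_on_g_ray cont u) (auto simp del: of_nat_Suc)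
  have b: "norm (g (of_real (2 * pi * real (Suc n)) * (u * of_real s)) / of_nat (Suc n) * \<phi> s) \<le> B n * exp (- (c n * s))"
    if "s > 0" for n s
  proof -
    have "norm (g (of_real (2 * pi * real (Suc n)) * (u * of_real s)) / of_nat (Suc n) * \<phi> s)
      \<le> (C * exp (- (pi * real (Suc n) / (2 * \<alpha>) * Re (u * of_real s))) / real (Suc n)) * D"
      unfolding norm_mult[of _ "\<phi> s"]
      using C_nonneg that by (intro mult_mono g_scaled_bound ray_in_cone u bound) auto
    also have "\<dots> = B n * exp (- (c n * s))" using u by (simp add: B_def c_def)
    finally show ?thesis .
  qed
  have "(\<lambda>n. B n / c n) = (\<lambda>n. (C * D * 2 * \<alpha> / pi) * (1 / real (Suc n) ^ 2))"
    using \<alpha>_pos by (auto simp: B_def c_def field_simps power2_eq_square)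
  moreover have "summable (\<lambda>n. (C * D * 2 * \<alpha> / pi) * (1 / real (Suc n) ^ 2))"
    using inverse_power_summable[of 2, where 'a = real]
    by (intro summable_mult) (subst summable_Suc_iff, simp add: inverse_eq_divide)
  ultimately have s1: "summable (\<lambda>n. B n / c n)" by simp
  have s2: "summable (\<lambda>n. norm (g (of_real (2 * pi * real (Suc n)) * (u * of_real s)) / of_nat (Suc n) * \<phi> s))"
    if "s > 0" for s
    unfolding norm_mult[of _ "\<phi> s"] using u that by (intro summable_mult2 F_summable ray_in_cone)
  have e: "F (u * of_real s) * \<phi> s = (\<Sum>n. g (of_real (2 * pi * real (Suc n)) * (u * of_real s)) / of_nat (Suc n) * \<phi> s)"
    if "s > 0" for s
    unfolding F_def using u that
    by (intro suminf_mult2 summable_norm_cancel[OF F_summable] ray_in_cone)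
  show "set_integrable lborel {0<..} (\<lambda>s. F (u * of_real s) * \<phi> s)"
    "(\<lambda>n. LBINT s:{0<..}. g (of_real (2 * pi * real (Suc n)) * (u * of_real s)) / of_nat (Suc n) * \<phi> s)
        sums (LBINT s:{0<..}. F (u * of_real s) * \<phi> s)"
    by (rule exp_dominated_suminf[OF c cf b s1 s2 e]; assumption)+
qed

lemma ray_not_Ints: "w * of_real s / (2 * pi) \<notin> \<int>" if "s > 0"
  using that K_pos by (auto simp: w_def elim!: Ints_cases simp: complex_eq_iff)

lemma square_ray_neq: "(of_real a)\<^sup>2 \<noteq> (w * of_real s)\<^sup>2" if "a > 0" "s \<ge> 0"
  using norm_diff_square_ge[OF that] c\<^sub>w_pos that by (auto simp: zero_less_power mult_le_0_iff)

text \<open>In contrast to F, the decay comes from g alone, at one rate for all n; summability in n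
  comes from \<open>norm_diff_square_ge\<close>.\<close>

lemma P_ray_integral:
  shows "set_integrable lborel {0<..} (\<lambda>s. P_minus_integrand \<alpha> \<nu> (w * of_real s) * w)"
    and "(\<lambda>n. LBINT s:{0<..}. g (w * of_real s) * (- 4 / ((of_real (2 * pi * real (Suc n)))\<^sup>2 - (w * of_real s)\<^sup>2)) * w)
        sums (LBINT s:{0<..}. P_minus_integrand \<alpha> \<nu> (w * of_real s) * w)"
proof -
  let ?f = "\<lambda>n s. g (w * of_real s) * (- 4 / ((of_real (2 * pi * real (Suc n)))\<^sup>2 - (w * of_real s)\<^sup>2)) * w"
  define B where "B n = C * (4 / (c\<^sub>w * (2 * pi * real (Suc n))\<^sup>2)) * norm w" for n
  have cf: "continuous_on {0<..} (?f n)" for n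
    using continuous_on_g_ray[of w 1] w_simps square_ray_neq[of "2 * pi * real (Suc n)"]
    by (intro continuous_intros) (auto simp del: of_nat_Suc)
  have b: "norm (?f n s) \<le> B n * exp (- (1 / (4 * \<alpha>) * s))" if "s > 0" for n s
  proof -
    have "norm (g (w * of_real s)) \<le> C * exp (- (Re (w * of_real s) / (4 * \<alpha>)))"
      using w_simps that by (intro g_bound ray_in_cone)
    moreover have "norm (- 4 / ((of_real (2 * pi * real (Suc n)))\<^sup>2 - (w * of_real s)\<^sup>2))
        \<le> 4 / (c\<^sub>w * (2 * pi * real (Suc n))\<^sup>2)"
      unfolding norm_divide using norm_diff_square_ge[of "2 * pi * real (Suc n)" s] that c\<^sub>w_pos
      by (intro frac_le) (auto simp del: of_nat_Suc)
    ultimately have "norm (?f n s) \<le> (C * exp (- (Re (w * of_real s) / (4 * \<alpha>)))) *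
        (4 / (c\<^sub>w * (2 * pi * real (Suc n))\<^sup>2)) * norm w"
      unfolding norm_mult using C_nonneg c\<^sub>w_pos by (intro mult_mono) (auto intro!: mult_nonneg_nonneg divide_nonneg_nonneg)
    also have "\<dots> = B n * exp (- (1 / (4 * \<alpha>) * s))" by (simp add: B_def w_simps)
    finally show ?thesis .
  qed
  have "B = (\<lambda>n. (C * norm w / (c\<^sub>w * pi\<^sup>2)) * (1 / real (Suc n) ^ 2))"
    by (auto simp: B_def power_mult_distrib simp del: of_nat_Suc)
  moreover have "summable (\<lambda>n. (C * norm w / (c\<^sub>w * pi\<^sup>2)) * (1 / real (Suc n) ^ 2))"
    using inverse_power_summable[of 2, where 'a = real]
    by (intro summable_mult) (subst summable_Suc_iff, simp add: inverse_eq_divide)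
  ultimately have sB: "summable B" by simp
  then have s1: "summable (\<lambda>n. B n / (1 / (4 * \<alpha>)))" by (rule summable_divide)
  have s2: "summable (\<lambda>n. norm (?f n s))" if "s > 0" for s
    by (rule summable_comparison_test'[OF summable_mult2[OF sB]]) (use b[OF that] in simp)
  have e: "P_minus_integrand \<alpha> \<nu> (w * of_real s) * w = (\<Sum>n. ?f n s)" if "s > 0" for s
  proof -
    have "(\<lambda>n. ?f n s) sums (g (w * of_real s) * ((cot (w * of_real s / 2) - 2 / (w * of_real s)) * (1 / (w * of_real s))) * w)"
      using cot_minus_inverse_sums[OF ray_not_Ints[OF that]]
      by (intro sums_mult sums_mult2) simp
    then show ?thesis
      by (simp add: sums_iff P_minus_integrand_def g_def mult.assoc)
  qed
  show "set_integrable lborel {0<..} (\<lambda>s. P_minus_integrand \<alpha> \<nu> (w * of_real s) * w)"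
    "(\<lambda>n. LBINT s:{0<..}. ?f n s) sums (LBINT s:{0<..}. P_minus_integrand \<alpha> \<nu> (w * of_real s) * w)"
    by (rule exp_dominated_suminf[where c = "\<lambda>_. 1 / (4 * \<alpha>)", OF _ cf b s1 s2 e]; (use \<alpha>_pos in simp)?)+
qed

definition Q :: "complex \<Rightarrow> complex" where "Q t = F t * (1 / (1 - t\<^sup>2))"

lemma Q_ray_integral:
  shows "set_integrable lborel {0<..} (\<lambda>s. Q (w * of_real s) * w)"
    and "(LBINT s:{0<..}. P_minus_integrand \<alpha> \<nu> (w * of_real s) * w)
      = - (2 / pi) * (LBINT s:{0<..}. Q (w * of_real s) * w)"
proof -
  let ?\<phi> = "\<lambda>s. 1 / (1 - (w * of_real s)\<^sup>2) * w"
  have cont: "continuous_on {0<..} ?\<phi>"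
    using square_ray_neq[of 1] by (intro continuous_intros) auto
  have bound: "norm (?\<phi> s) \<le> 1 / c\<^sub>w * norm w" if "s > 0" for s
  proof -
    have "norm (1 / (1 - (w * of_real s)\<^sup>2)) \<le> 1 / c\<^sub>w"
      unfolding norm_divide using norm_diff_square_ge[of 1 s] that c\<^sub>w_pos by (intro frac_le) auto
    then show ?thesis unfolding norm_mult by (intro mult_right_mono) auto
  qed
  note I = F_ray_integral[OF w_simps(1,3) cont bound]
  show "set_integrable lborel {0<..} (\<lambda>s. Q (w * of_real s) * w)"
    using I(1) by (simp add: Q_def mult.assoc)
  have scale: "(LBINT s:{0<..}. g (w * of_real s) * (- 4 / ((of_real (2 * pi * real (Suc n)))\<^sup>2 - (w * of_real s)\<^sup>2)) * w)
     = - (2 / pi) * (LBINT s:{0<..}. g (of_real (2 * pi * real (Suc n)) * (w * of_real s)) / of_nat (Suc n) * ?\<phi> s)" for n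
  proof -
    define m where "m = 2 * pi * real (Suc n)"
    have m: "m > 0" by (simp add: m_def)
    let ?h = "\<lambda>s. indicator {0<..} s *\<^sub>R (g (w * of_real s) * (- 4 / ((of_real m)\<^sup>2 - (w * of_real s)\<^sup>2)) * w)"
    have "(LBINT s. ?h s) = \<bar>m\<bar> *\<^sub>R (LBINT s. ?h (0 + m * s))"
      by (rule lborel_integral_real_affine) (use m in simp)
    also have "\<dots> = (LBINT s. m *\<^sub>R ?h (m * s))"
      using m by (simp only: abs_of_pos add_0 integral_scaleR_right)
    also have "(\<lambda>s. m *\<^sub>R ?h (m * s)) = (\<lambda>s. - (2 / pi) * (indicator {0<..} s *\<^sub>R (g (of_real m * (w * of_real s)) / of_nat (Suc n) * ?\<phi> s)))"
    proof
      fix s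
      show "m *\<^sub>R ?h (m * s) = - (2 / pi) * (indicator {0<..} s *\<^sub>R (g (of_real m * (w * of_real s)) / of_nat (Suc n) * ?\<phi> s))"
      proof (cases "s > 0")
        case True
        have comm: "M * X = Y \<Longrightarrow> M * (G * X * W) = G * Y * W" for M X Y G W :: complex
          by (auto simp: mult_ac)
        have nz: "1 - (w * of_real s)\<^sup>2 \<noteq> 0" using square_ray_neq[of 1 s] True by auto
        have "(of_real m)\<^sup>2 - (w * of_real (m * s))\<^sup>2 = (of_real m)\<^sup>2 * (1 - (w * of_real s)\<^sup>2)"
          by (simp add: power2_eq_square algebra_simps)
        \<comment> \<open>One factor m is the Jacobian; against m^2 it leaves 4 / m = (2 / \<pi>) /
          (n + 1) in terms of the index n.\<close>
        moreover have "of_real m * (- 4 / ((of_real m)\<^sup>2 * (1 - (w * of_real s)\<^sup>2))) =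
            - (2 / pi) / of_nat (Suc n) * (1 / (1 - (w * of_real s)\<^sup>2))"
          using nz by (simp add: m_def divide_simps power2_eq_square del: of_nat_Suc)
        ultimately have "of_real m * (- 4 / ((of_real m)\<^sup>2 - (w * of_real (m * s))\<^sup>2)) =
            - (2 / pi) / of_nat (Suc n) * (1 / (1 - (w * of_real s)\<^sup>2))" by simp
        then have "of_real m * (g (w * of_real (m * s)) * (- 4 / ((of_real m)\<^sup>2 - (w * of_real (m * s))\<^sup>2)) * w)
            = g (w * of_real (m * s)) * (- (2 / pi) / of_nat (Suc n) * (1 / (1 - (w * of_real s)\<^sup>2))) * w"
          by (rule comm)
        also have "\<dots> = - (2 / pi) * (g (of_real m * (w * of_real s)) / of_nat (Suc n) * ?\<phi> s)"
          by (simp add: mult_ac del: of_nat_Suc)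
        finally have eq: "of_real m * (g (w * of_real (m * s)) * (- 4 / ((of_real m)\<^sup>2 - (w * of_real (m * s))\<^sup>2)) * w)
            = - (2 / pi) * (g (of_real m * (w * of_real s)) / of_nat (Suc n) * ?\<phi> s)" .
        have ind: "indicator {0<..} (m * s) = (1 :: real)" "indicator {0<..} s = (1 :: real)"
          using True m by auto
        show ?thesis unfolding ind scaleR_conv_of_real of_real_1 mult_1_left by (rule eq)
      next
        case False
        then show ?thesis using m by (simp add: zero_less_mult_iff)
      qed
    qed
    also have "(LBINT s. - (2 / pi) * (indicator {0<..} s *\<^sub>R (g (of_real m * (w * of_real s)) / of_nat (Suc n) * ?\<phi> s)))
      = - (2 / pi) * (LBINT s. indicator {0<..} s *\<^sub>R (g (of_real m * (w * of_real s)) / of_nat (Suc n) * ?\<phi> s))"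
      by (rule integral_mult_right_zero)
    finally show ?thesis by (simp only: set_lebesgue_integral_def m_def)
  qed
  have "(\<lambda>n. LBINT s:{0<..}. g (w * of_real s) * (- 4 / ((of_real (2 * pi * real (Suc n)))\<^sup>2 - (w * of_real s)\<^sup>2)) * w)
        sums (- (2 / pi) * (LBINT s:{0<..}. F (w * of_real s) * ?\<phi> s))"
    unfolding scale by (intro sums_mult I(2))
  \<comment> \<open>The same series has been summed twice: as the partial fractions of P and, after
    scaling, as a multiple of the series for Q.\<close>
  from sums_unique2[OF P_ray_integral(2) this]
  show "(LBINT s:{0<..}. P_minus_integrand \<alpha> \<nu> (w * of_real s) * w)
      = - (2 / pi) * (LBINT s:{0<..}. Q (w * of_real s) * w)"
    by (simp add: Q_def mult.assoc)
qed

section \<open>Rotating the indented path\<close>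

abbreviation P :: "complex \<Rightarrow> complex" where "P \<equiv> P_minus_integrand \<alpha> \<nu>"

text \<open>The hypotheses exclude 0, the remaining zeros of exp (t / \<alpha>) - 1, and the zeros
  of sin (t / 2).\<close>

lemma P_holomorphic:
  assumes "0 \<notin> S" "\<And>t. t \<in> S \<Longrightarrow> \<bar>Im t\<bar> < 2 * pi * \<alpha> \<or> Re t \<noteq> 0"
    and "\<And>t n. t \<in> S \<Longrightarrow> t \<noteq> of_real (2 * pi * of_int n)"
  shows "P holomorphic_on S"
proof -
  have "sin (t / 2) \<noteq> 0" if "t \<in> S" for t
  proof
    assume "sin (t / 2) = 0"
    then obtain n :: int where "t / 2 = of_real (n * pi)" by (auto simp: Complex_Transcendental.sin_eq_0)
    then have "t = of_real (2 * pi * of_int n)" by (simp add: field_simps)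
    then show False using assms(3)[OF that, of n] by simp
  qed
  moreover have "exp (t / of_real \<alpha>) - 1 \<noteq> 0" "t \<noteq> 0" if "t \<in> S" for t
    using exp_divide_neq_1[of t] assms that by auto
  ultimately show ?thesis unfolding P_minus_integrand_def cot_def
    using \<alpha>_pos by (intro holomorphic_intros) auto
qed

text \<open>A convex box reaching to the nonzero singularities closest to 0 on each axis, namely 2
  \<pi> and 2 \<pi> \<alpha> \<i> up to sign.\<close>

definition W\<^sub>0 :: "complex set" where "W\<^sub>0 = box (Complex (-2 * pi) (-2 * pi * \<alpha>)) (Complex (2 * pi) (2 * pi * \<alpha>))"

lemma in_W\<^sub>0: "z \<in> W\<^sub>0 \<longleftrightarrow> \<bar>Re z\<bar> < 2 * pi \<and> \<bar>Im z\<bar> < 2 * pi * \<alpha>"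
  by (auto simp: W\<^sub>0_def in_box_complex_iff)

lemma zero_in_W\<^sub>0: "0 \<in> W\<^sub>0" using \<alpha>_pos by (simp add: in_W\<^sub>0)

lemma tendsto_g_0: "(g \<longlongrightarrow> of_real (\<alpha> * \<nu>)) (at 0)"
  unfolding g_def[abs_def] using \<alpha>_pos
  by (intro lhopital_complex_simple[where f' = "of_real \<nu>" and g' = "1 / of_real \<alpha>"])
     (auto intro!: derivative_eq_intros)

text \<open>The singularity at 0 is removable since t P(t) tends to 0. \<open>P 0\<close> is only
  the default value 0 of a division by zero, so a separate \<open>f\<close> carries the
  limit.\<close>

lemma P_extension:
  obtains f where "f holomorphic_on W\<^sub>0" "\<And>z. z \<in> W\<^sub>0 - {0} \<Longrightarrow> f z = P z"
proof -
  have open_W: "open W\<^sub>0" unfolding W\<^sub>0_def by (rule open_box)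
  have hol: "P holomorphic_on (W\<^sub>0 - {0})"
  proof (rule P_holomorphic)
    show "t \<noteq> of_real (2 * pi * of_int n)" if "t \<in> W\<^sub>0 - {0}" for t n
      using that real_multiple_2pi[of n] by (auto simp: in_W\<^sub>0)
  qed (auto simp: in_W\<^sub>0)
  have "((\<lambda>t. g t * (cot (t / 2) - 2 / t)) \<longlongrightarrow> of_real (\<alpha> * \<nu>) * 0) (at 0)"
    by (intro tendsto_mult tendsto_g_0 tendsto_cot_minus_inverse)
  moreover have "\<forall>\<^sub>F t in at 0. g t * (cot (t / 2) - 2 / t) = (t - 0) * P t"
    by (auto simp: eventually_at_filter g_def P_minus_integrand_def)
  ultimately have "((\<lambda>t. (t - 0) * P t) \<longlongrightarrow> 0) (at 0)"
    by (auto intro: Lim_transform_eventually)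
  then show ?thesis
    using holomorphic_on_extend_lim[OF hol] zero_in_W\<^sub>0 open_W that by (auto simp: interior_open)
qed

lemma set_integrable_ray_closed:
  "set_integrable lborel {0..} (\<lambda>s. P (w * of_real s) * w)"
  "(LBINT s:{0..}. P (w * of_real s) * w) = (LBINT s:{0<..}. P (w * of_real s) * w)"
proof -
  \<comment> \<open>The two sides agree at s = 0 as well, because \<open>P 0 = 0\<close> by division
    by zero.\<close>
  have "(\<lambda>s. indicator {0..} s *\<^sub>R (P (w * of_real s) * w)) = (\<lambda>s. indicator {0<..} s *\<^sub>R (P (w * of_real s) * w))"
    by (auto simp: indicator_def P_minus_integrand_def)
  then show "set_integrable lborel {0..} (\<lambda>s. P (w * of_real s) * w)"
    "(LBINT s:{0..}. P (w * of_real s) * w) = (LBINT s:{0<..}. P (w * of_real s) * w)"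
    using P_ray_integral(1) by (simp_all only: set_integrable_def set_lebesgue_integral_def)
qed

lemma Re_closed_segment_vertical:
  assumes "z \<in> closed_segment (w * of_real p) (of_real p)" "p > 0"
  shows "Re z = p" "- (K / 2 * p) \<le> Im z" "Im z \<le> 0"
proof -
  obtain t where t: "0 \<le> t" "t \<le> 1" "z = (1 - t) *\<^sub>R (w * of_real p) + t *\<^sub>R of_real p"
    using assms by (auto simp: in_segment)
  show "Re z = p" unfolding t(3) by (simp add: w_simps) (simp add: algebra_simps)
  have Im: "Im z = - ((1 - t) * (K / 2 * p))" using t by (simp add: w_simps)
  have "0 \<le> (1 - t) * (K / 2 * p)" using t assms K_pos by simp
  moreover have "(1 - t) * (K / 2 * p) \<le> 1 * (K / 2 * p)" using t assms K_pos by (intro mult_right_mono) auto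
  ultimately show "- (K / 2 * p) \<le> Im z" "Im z \<le> 0" using Im by auto
qed

text \<open>The open strip contains a single zero of sin (t / 2), and this is the foot of the slit.
  For n = 0 its left edge is the imaginary axis, which it omits.\<close>

lemma P_strip_holomorphic:
  "P holomorphic_on ({z. 2 * pi * real n < Re z \<and> Re z < 2 * pi * real (Suc (Suc n))} -
      {z. Re z = 2 * pi * real (Suc n) \<and> Im z \<ge> 0})"
proof (rule P_holomorphic)
  fix t :: complex and m :: int
  assume t: "t \<in> {z. 2 * pi * real n < Re z \<and> Re z < 2 * pi * real (Suc (Suc n))} -
      {z. Re z = 2 * pi * real (Suc n) \<and> Im z \<ge> 0}"
  show "t \<noteq> of_real (2 * pi * of_int m)"
  proof
    assume "t = of_real (2 * pi * of_int m)"
    then have *: "2 * pi * real n < 2 * pi * of_int m" "2 * pi * of_int m < 2 * pi * real (Suc (Suc n))"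
      "2 * pi * of_int m \<noteq> 2 * pi * real (Suc n)" using t by auto
    then have "real_of_int (int n) < of_int m" "of_int m < real_of_int (int (Suc (Suc n)))"
      by (auto simp del: of_nat_Suc)
    then have "m = int (Suc n)" unfolding of_int_less_iff by linarith
    then show False using * by simp
  qed
  have "0 \<le> 2 * pi * real n" by simp
  then show "\<bar>Im t\<bar> < 2 * pi * \<alpha> \<or> Re t \<noteq> 0" using t by (metis (lifting) Diff_iff mem_Collect_eq not_less)
qed (simp add: not_less)

lemma P_contour_initial_segment:
  assumes r: "0 < r" "r < 1"
  shows "(P has_contour_integral (LBINT s=0..node r 1. P (w * of_real s) * w) +
      contour_integral (linepath (w * of_real (node r 1)) (of_real (node r 1))) P) (linepath 0 (of_real (node r 1)))"
proof -
  define p where "p = node r 1"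
  have p: "0 < p" "p < 2 * pi" using r pi_gt3 by (auto simp: p_def node_def)
  obtain f where f: "f holomorphic_on W\<^sub>0" "\<And>z. z \<in> W\<^sub>0 - {0} \<Longrightarrow> f z = P z"
    using P_extension by blast
  have op: "open W\<^sub>0" unfolding W\<^sub>0_def by (rule open_box)
  obtain \<Phi> where "\<And>z. z \<in> W\<^sub>0 \<Longrightarrow> (\<Phi> has_field_derivative f z) (at z within W\<^sub>0)"
    using holomorphic_convex_primitive'[of W\<^sub>0 f] f op by (auto simp: W\<^sub>0_def convex_box)
  then have \<Phi>: "(\<Phi> has_field_derivative f z) (at z)" if "z \<in> W\<^sub>0" for z
    using that op by (metis at_within_open)
  have pW: "of_real p \<in> W\<^sub>0" using p \<alpha>_pos by (simp add: in_W\<^sub>0)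
  have ray: "w * of_real s \<in> W\<^sub>0" if "0 \<le> s" "s \<le> p" for s
  proof -
    \<comment> \<open>This is where \<open>K \<le> \<alpha>\<close> enters: up to abscissa 2 \<pi>
      the ray is at most \<pi> \<alpha> deep.\<close>
    have "K / 2 * s \<le> \<alpha> / 2 * (2 * pi)" using K_le K_pos p that \<alpha>_pos by (intro mult_mono) auto
    also have "\<dots> < 2 * pi * \<alpha>" using \<alpha>_pos by simp
    finally show ?thesis using p that K_pos by (simp add: in_W\<^sub>0 w_simps abs_mult)
  qed
  have ray0: "w * of_real s \<noteq> 0" if "0 < s" for s using that by (auto simp: complex_eq_iff w_simps)
  have "(f has_contour_integral (\<Phi> (of_real p) - \<Phi> 0)) (linepath 0 (of_real p))"
    using contour_integral_primitive[of W\<^sub>0 \<Phi> f "linepath 0 (of_real p)"] \<Phi> pW zero_in_W\<^sub>0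
    by (auto simp: has_field_derivative_at_within closed_segment_subset W\<^sub>0_def convex_box)
  then have "((\<lambda>x. f (linepath 0 (of_real p) x) * (of_real p - 0)) has_integral (\<Phi> (of_real p) - \<Phi> 0)) {0..1}"
    by (simp only: has_contour_integral_linepath)
  then have "((\<lambda>x. P (linepath 0 (of_real p) x) * (of_real p - 0)) has_integral (\<Phi> (of_real p) - \<Phi> 0)) {0..1}"
  \<comment> \<open>P and its extension differ at most at the starting point 0.\<close>
  proof (rule has_integral_spike_finite[of "{0}", rotated 2])
    fix x :: real assume x: "x \<in> {0..1} - {0}"
    have "linepath 0 (of_real p) x = complex_of_real (x * p)" by (simp add: linepath_def scaleR_conv_of_real)
    moreover have "\<bar>x * p\<bar> < 2 * pi"
    proof -
      have "x * p \<le> 1 * p" using x p by (intro mult_right_mono) auto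
      moreover have "0 \<le> x * p" using x p by simp
      ultimately show ?thesis using p by linarith
    qed
    ultimately have "linepath 0 (of_real p) x \<in> W\<^sub>0 - {0}"
      using x p \<alpha>_pos by (auto simp: in_W\<^sub>0)
    then show "P (linepath 0 (of_real p) x) * (of_real p - 0) = f (linepath 0 (of_real p) x) * (of_real p - 0)"
      by (simp add: f)
  qed auto
  then have 1: "(P has_contour_integral (\<Phi> (of_real p) - \<Phi> 0)) (linepath 0 (of_real p))"
    by (simp only: has_contour_integral_linepath)
  have "(LBINT s=0..p. P (w * of_real s) * w) = (LBINT s:{0<..p}. P (w * of_real s) * w)"
    unfolding zero_ereal_def using p by (intro interval_integral_Ioc) simp
  also have "\<dots> = (LBINT s:{0<..p}. f (w * of_real s) * w)"
    using ray ray0 by (intro set_lebesgue_integral_cong) (auto simp: f)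
  also have "\<dots> = (LBINT s=0..p. f (w * of_real s) * w)"
    unfolding zero_ereal_def using p by (intro interval_integral_Ioc[symmetric]) simp
  also have "\<dots> = \<Phi> (w * of_real p) - \<Phi> (w * of_real 0)"
    unfolding zero_ereal_def using ray p
    by (intro ray_integral_primitive[OF \<Phi> holomorphic_on_imp_continuous_on[OF f(1)]]) auto
  finally have 2: "(LBINT s=0..p. P (w * of_real s) * w) = \<Phi> (w * of_real p) - \<Phi> 0" by simp
  have seg: "closed_segment (w * of_real p) (of_real p) \<subseteq> W\<^sub>0"
    using ray[of p] pW p by (intro closed_segment_subset) (auto simp: W\<^sub>0_def convex_box)
  have "(f has_contour_integral (\<Phi> (of_real p) - \<Phi> (w * of_real p))) (linepath (w * of_real p) (of_real p))"
    using contour_integral_primitive[of W\<^sub>0 \<Phi> f "linepath (w * of_real p) (of_real p)"] \<Phi> seg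
    by (auto simp: has_field_derivative_at_within)
  then have "(P has_contour_integral (\<Phi> (of_real p) - \<Phi> (w * of_real p))) (linepath (w * of_real p) (of_real p))"
  proof (rule has_contour_integral_eq)
    fix z assume z: "z \<in> path_image (linepath (w * of_real p) (of_real p))"
    then have "Re z = p" using Re_closed_segment_vertical(1)[of z p] p by simp
    then have "z \<in> W\<^sub>0 - {0}" using z seg p by auto
    then show "f z = P z" by (rule f)
  qed
  then have 3: "contour_integral (linepath (w * of_real p) (of_real p)) P = \<Phi> (of_real p) - \<Phi> (w * of_real p)"
    by (rule contour_integral_unique)
  from 1 2 3 show ?thesis by (simp add: p_def)
qed

text \<open>One primitive on the slit strip measures both routes from p to q: the semicircle with
  its segment, and the vertical down at p, the ray, and the vertical up at q. Adding the piece
  exchanges the vertical at p for that at q.\<close>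

lemma P_contour_ell_minus_step:
  assumes r: "0 < r" "r < 1"
    and IH: "(P has_contour_integral (LBINT s=0..node r (Suc N). P (w * of_real s) * w) +
      contour_integral (linepath (w * of_real (node r (Suc N))) (of_real (node r (Suc N)))) P) (ell_minus r N)"
  shows "(P has_contour_integral (LBINT s=0..node r (Suc (Suc N)). P (w * of_real s) * w) +
      contour_integral (linepath (w * of_real (node r (Suc (Suc N)))) (of_real (node r (Suc (Suc N))))) P) (ell_minus r (Suc N))"
proof -
  define p q where "p = node r (Suc N)" and "q = node r (Suc (Suc N))"
  define c where "c = 2 * pi * real (Suc N)"
  have pq: "1 < p" "p < q" "p = c - r" "q = c + 2 * pi - r"
    using node_less[of r] r by (auto simp: p_def q_def c_def node_def algebra_simps)
  define U where "U = {z. 2 * pi * real N < Re z \<and> Re z < 2 * pi * real (Suc (Suc N))}"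
  have cU: "2 * pi * real N = c - 2 * pi" "2 * pi * real (Suc (Suc N)) = c + 2 * pi"
    by (auto simp: c_def algebra_simps)
  have U_eq: "U = {z. c - 2 * pi < Re z \<and> Re z < c + 2 * pi}" by (simp only: U_def cU)
  define S where "S = U - {z. Re z = c \<and> Im z \<ge> 0}"
  have hol: "P holomorphic_on S"
    using P_strip_holomorphic[of N] by (simp only: S_def U_def c_def)
  obtain \<Phi> where \<Phi>: "\<And>z. z \<in> S \<Longrightarrow> (\<Phi> has_field_derivative P z) (at z)"
  proof (rule slit_primitive[of U "Complex c (-1)" c P])
    show "convex U" "open U" unfolding U_def by (rule convex_strip open_strip)+
    show "Complex c (-1) \<in> U" by (simp add: U_eq)
  qed (use hol in \<open>auto simp: S_def\<close>)
  have prim: "(P has_contour_integral (\<Phi> (pathfinish \<gamma>) - \<Phi> (pathstart \<gamma>))) \<gamma>"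
    if "valid_path \<gamma>" "path_image \<gamma> \<subseteq> S" for \<gamma>
    using contour_integral_primitive[OF _ that] \<Phi> by (blast intro: has_field_derivative_at_within)
  have inS: "z \<in> S" if "c - 2 * pi < Re z" "Re z < c + 2 * pi" "Re z \<noteq> c" for z
    using that by (simp add: S_def U_eq)
  have inS': "z \<in> S" if "p \<le> Re z" "Re z \<le> q" "Im z < 0" for z
    using that pq r pi_gt3 by (simp add: S_def U_eq)
  define \<gamma> where "\<gamma> = part_circlepath (of_real c) r pi (2 * pi) +++ linepath (of_real (c + r)) (of_real q)"
  have v: "valid_path \<gamma>" unfolding \<gamma>_def
    by (intro valid_path_join valid_path_part_circlepath valid_path_linepath)
       (simp add: semicircle_endpoints del: pathstart_part_circlepath pathfinish_part_circlepath)
  have "path_image \<gamma> \<subseteq> path_image (part_circlepath (of_real c) r pi (2 * pi)) \<union> closed_segment (of_real (c + r)) (of_real q)"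
    unfolding \<gamma>_def using path_image_join_subset by fastforce
  also have "\<dots> \<subseteq> S"
  proof (intro Un_least subsetI)
    fix z assume "z \<in> path_image (part_circlepath (of_real c) r pi (2 * pi))"
    from lower_semicircle_avoids_slit[OF this r(1)] show "z \<in> S"
      using r pi_gt3 by (auto simp: S_def U_eq)
  next
    fix z assume "z \<in> closed_segment (complex_of_real (c + r)) (of_real q)"
    then obtain y where "z = of_real y" "y \<in> closed_segment (c + r) q"
      by (metis closed_segment_of_real imageE)
    then have "c + r \<le> Re z" "Re z \<le> q"
      using pq r pi_gt3 by (auto simp: closed_segment_eq_real_ivl)
    then show "z \<in> S" using pq r by (intro inS) auto
  qed
  finally have \<gamma>: "(P has_contour_integral (\<Phi> (of_real q) - \<Phi> (of_real p))) \<gamma>"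
    using prim[OF v] pq
    by (simp add: \<gamma>_def semicircle_endpoints del: pathstart_part_circlepath pathfinish_part_circlepath)
  have vert: "contour_integral (linepath (w * of_real x) (of_real x)) P = \<Phi> (of_real x) - \<Phi> (w * of_real x)"
    if "x = p \<or> x = q" for x
  proof -
    have "x > 0" using that pq by linarith
    have "path_image (linepath (w * of_real x) (of_real x)) \<subseteq> S"
    proof
      fix z assume "z \<in> path_image (linepath (w * of_real x) (of_real x))"
      then have "Re z = x" using Re_closed_segment_vertical(1)[of z x] \<open>x > 0\<close> by simp
      then show "z \<in> S" using that pq r pi_gt3 by (intro inS) auto
    qed
    from prim[OF _ this] show ?thesis by (simp add: contour_integral_unique)
  qed
  have ray: "(LBINT s=p..q. P (w * of_real s) * w) = \<Phi> (w * of_real q) - \<Phi> (w * of_real p)"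
  proof (rule ray_integral_primitive[OF \<Phi> holomorphic_on_imp_continuous_on[OF hol]])
    show "w * of_real s \<in> S" if "p \<le> s" "s \<le> q" for s
      using that pq K_pos by (intro inS') (auto simp: w_simps)
  qed (use pq in auto)
  have split: "(LBINT s=0..p. P (w * of_real s) * w) + (LBINT s=p..q. P (w * of_real s) * w)
      = (LBINT s=0..q. P (w * of_real s) * w)"
  proof (rule interval_integral_sum)
    have "min 0 (min (ereal p) (ereal q)) = 0" "max 0 (max (ereal p) (ereal q)) = ereal q"
      using pq(1,2) by (auto simp: min_def max_def)
    moreover have "set_integrable lborel (einterval 0 (ereal q)) (\<lambda>s. P (w * of_real s) * w)"
      by (rule set_integrable_subset[OF P_ray_integral(1)]) (auto simp: einterval_def zero_ereal_def)
    ultimately show "interval_lebesgue_integrable lborel (min 0 (min (ereal p) (ereal q))) (max 0 (max (ereal p) (ereal q)))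
        (\<lambda>s. P (w * of_real s) * w)"
      using pq(1,2) by (simp add: interval_lebesgue_integrable_def)
  qed
  have "(P has_contour_integral ((LBINT s=0..p. P (w * of_real s) * w) +
      contour_integral (linepath (w * of_real p) (of_real p)) P) + (\<Phi> (of_real q) - \<Phi> (of_real p))) (ell_minus r N +++ \<gamma>)"
    by (rule has_contour_integral_join[OF IH[folded p_def] \<gamma> valid_path_ell_minus v])
  also have "((LBINT s=0..p. P (w * of_real s) * w) +
      contour_integral (linepath (w * of_real p) (of_real p)) P) + (\<Phi> (of_real q) - \<Phi> (of_real p)) =
      (LBINT s=0..q. P (w * of_real s) * w) + contour_integral (linepath (w * of_real q) (of_real q)) P"
    unfolding split[symmetric] ray vert[OF disjI1[OF refl]] vert[OF disjI2[OF refl]] by simp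
  \<comment> \<open>\<open>+++\<close> associates to the right, so \<gamma> is exactly the tail
    appended by the recursion.\<close>
  also have "ell_minus r N +++ \<gamma> = ell_minus r (Suc N)"
    by (simp only: ell_minus.simps \<gamma>_def c_def q_def node_def) (simp only: Suc_eq_plus1)
  finally show ?thesis
    by (simp only: q_def)
qed

lemma P_contour_ell_minus:
  assumes r: "0 < r" "r < 1"
  shows "(P has_contour_integral (LBINT s=0..node r (Suc N). P (w * of_real s) * w) +
      contour_integral (linepath (w * of_real (node r (Suc N))) (of_real (node r (Suc N)))) P) (ell_minus r N)"
proof (induction N)
  case 0
  have "linepath 0 (of_real (node r 1)) = ell_minus r 0" by (simp add: node_def)
  then show ?case using P_contour_initial_segment[OF r] by (simp only: One_nat_def)
qed (rule P_contour_ell_minus_step[OF r])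

text \<open>The product of \<open>g_bound\<close>, the cotangent bound at abscissa p, norm z >= 1
  for both 2 / z and 1 / z, and the length K p / 2 of the segment.\<close>

lemma vertical_bound:
  fixes r :: real and N :: nat
  assumes r: "0 < r" "r < 1"
  defines "p \<equiv> node r (Suc N)"
  shows "norm (contour_integral (linepath (w * of_real p) (of_real p)) P)
    \<le> C * exp (- (p / (4 * \<alpha>))) * (1 / sin (r / 2) + 2) * (K / 2 * p)"
proof -
  have p: "p > 1" using node_less r by (simp add: p_def)
  have sr: "sin (r / 2) > 0" using r pi_gt3 by (intro sin_gt_zero) auto
  have sp: "\<bar>sin (p / 2)\<bar> = sin (r / 2)" using sin_node[of r N] sr by (simp add: p_def)
  have Re: "Re z = p" "\<bar>Im z\<bar> \<le> K / 2 * p" if "z \<in> closed_segment (w * of_real p) (of_real p)" for z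
    using Re_closed_segment_vertical[OF that] p by auto
  have "P holomorphic_on closed_segment (w * of_real p) (of_real p)"
  proof (rule P_holomorphic)
    fix t and n :: int assume t: "t \<in> closed_segment (w * of_real p) (of_real p)"
    show "t \<noteq> of_real (2 * pi * of_int n)"
    proof
      assume "t = of_real (2 * pi * of_int n)"
      then have "p / 2 = of_int n * pi" using Re(1)[OF t] by auto
      then have "sin (p / 2) = 0" by (metis sin_zero_iff_int2)
      then show False using sp sr by simp
    qed
  qed (use Re p in force)+
  then have "P contour_integrable_on linepath (w * of_real p) (of_real p)"
    by (intro contour_integrable_continuous_linepath holomorphic_on_imp_continuous_on)
  then have "norm (contour_integral (linepath (w * of_real p) (of_real p)) P)
      \<le> C * exp (- (p / (4 * \<alpha>))) * (1 / sin (r / 2) + 2) * norm (of_real p - w * of_real p)"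
  proof (rule contour_integral_bound_linepath)
    show "0 \<le> C * exp (- (p / (4 * \<alpha>))) * (1 / sin (r / 2) + 2)" using C_nonneg sr by simp
    fix z assume z: "z \<in> closed_segment (w * of_real p) (of_real p)"
    note Re = Re[OF z]
    have "\<bar>Im z\<bar> < K * Re z"
      using Re mult_pos_pos[OF K_pos, of p] p by simp
    then have gb: "norm (g z) \<le> C * exp (- (Re z / (4 * \<alpha>)))"
      using Re p by (intro g_bound) (simp add: cone_def)
    have nz: "norm z \<ge> 1" using complex_Re_le_cmod[of z] Re p by simp
    have "norm (cot (z / 2) - 2 / z) \<le> norm (cot (z / 2)) + norm (2 / z)" by (rule norm_triangle_ineq4)
    also have "\<dots> \<le> 1 / sin (r / 2) + 2"
    proof (rule add_mono)
      show "norm (cot (z / 2)) \<le> 1 / sin (r / 2)"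
        using norm_cot_le[of "z / 2"] sp sr Re by auto
      show "norm (2 / z) \<le> 2" using nz frac_le[of 2 2 1 "norm z"] by (simp add: norm_divide)
    qed
    finally have cb: "norm (cot (z / 2) - 2 / z) \<le> 1 / sin (r / 2) + 2" .
    have "norm (1 / z) \<le> 1" using nz frac_le[of 1 1 1 "norm z"] by (simp add: norm_divide)
    with gb cb have "norm (g z) * norm (cot (z / 2) - 2 / z) * norm (1 / z)
        \<le> C * exp (- (Re z / (4 * \<alpha>))) * (1 / sin (r / 2) + 2) * 1"
      using C_nonneg sr by (intro mult_mono) auto
    then show "norm (P z) \<le> C * exp (- (p / (4 * \<alpha>))) * (1 / sin (r / 2) + 2)"
      by (simp add: P_minus_integrand_def g_def norm_mult norm_divide Re)
  qed
  also have "of_real p - w * of_real p = \<i> * of_real (K / 2 * p)"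
    by (simp add: complex_eq_iff w_simps)
  also have "norm (\<i> * of_real (K / 2 * p)) = K / 2 * p"
    unfolding norm_mult norm_of_real using K_pos p by simp
  finally show ?thesis .
qed

lemma vertical_tendsto_0:
  assumes r: "0 < r" "r < 1"
  shows "(\<lambda>N. contour_integral (linepath (w * of_real (node r (Suc N))) (of_real (node r (Suc N)))) P) \<longlonglongrightarrow> 0"
proof (rule Lim_null_comparison)
  show "\<forall>\<^sub>F N in sequentially. norm (contour_integral (linepath (w * of_real (node r (Suc N))) (of_real (node r (Suc N)))) P)
      \<le> C * (1 / sin (r / 2) + 2) * (K / 2) * (4 * \<alpha>) * ((node r (Suc N) / (4 * \<alpha>)) ^ 1 / exp (node r (Suc N) / (4 * \<alpha>)))"
  proof (rule always_eventually, rule allI)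
    fix N
    have "C * exp (- (p / (4 * \<alpha>))) * (1 / sin (r / 2) + 2) * (K / 2 * p) =
        C * (1 / sin (r / 2) + 2) * (K / 2) * (4 * \<alpha>) * ((p / (4 * \<alpha>)) ^ 1 / exp (p / (4 * \<alpha>)))" for p
      using \<alpha>_pos by (simp add: exp_minus field_simps)
    then show "norm (contour_integral (linepath (w * of_real (node r (Suc N))) (of_real (node r (Suc N)))) P)
      \<le> C * (1 / sin (r / 2) + 2) * (K / 2) * (4 * \<alpha>) * ((node r (Suc N) / (4 * \<alpha>)) ^ 1 / exp (node r (Suc N) / (4 * \<alpha>)))"
      using vertical_bound[OF r, of N] by (simp only:)
  qed
  have "filterlim (\<lambda>N. 1 / (4 * \<alpha>) * node r (Suc N)) at_top sequentially"
    using \<alpha>_pos by (intro filterlim_tendsto_pos_mult_at_top[OF tendsto_const] filterlim_node) auto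
  then have "filterlim (\<lambda>N. node r (Suc N) / (4 * \<alpha>)) at_top sequentially" by simp
  from filterlim_compose[OF tendsto_power_div_exp_0 this]
  have "(\<lambda>N. (node r (Suc N) / (4 * \<alpha>)) ^ 1 / exp (node r (Suc N) / (4 * \<alpha>))) \<longlonglongrightarrow> 0" .
  from tendsto_mult_right_zero[OF this]
  show "(\<lambda>N. C * (1 / sin (r / 2) + 2) * (K / 2) * (4 * \<alpha>) *
      ((node r (Suc N) / (4 * \<alpha>)) ^ 1 / exp (node r (Suc N) / (4 * \<alpha>)))) \<longlonglongrightarrow> 0" .
qed

text \<open>Each truncated path amounts to a truncated ray plus a vertical that tends to 0, so the
  limit is the ray integral for every admissible r.\<close>

lemma P_has_ell_minus_integral:
  assumes r: "0 < r" "r < 1"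
  shows "has_ell_minus_integral P (LBINT s:{0<..}. P (w * of_real s) * w) r"
  unfolding has_ell_minus_integral_def
proof (intro conjI allI)
  note I = P_contour_ell_minus[OF r]
  show "P contour_integrable_on ell_minus r N" for N
    using I unfolding contour_integrable_on_def by blast
  have "((\<lambda>b. LBINT s:{0..b}. P (w * of_real s) * w) \<longlongrightarrow> (LBINT s:{0..}. P (w * of_real s) * w)) at_top"
    by (rule tendsto_set_lebesgue_integral_at_top) (use set_integrable_ray_closed in auto)
  from filterlim_compose[OF this filterlim_node]
  have "(\<lambda>N. LBINT s:{0..node r (Suc N)}. P (w * of_real s) * w) \<longlonglongrightarrow> (LBINT s:{0<..}. P (w * of_real s) * w)"
    by (simp only: set_integrable_ray_closed)
  moreover have "(LBINT s:{0..node r (Suc N)}. P (w * of_real s) * w) = (LBINT s=0..node r (Suc N). P (w * of_real s) * w)" for N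
    unfolding zero_ereal_def using node_less(1)[OF r, of N] by (intro interval_integral_Icc[symmetric]) simp
  ultimately have "(\<lambda>N. LBINT s=0..node r (Suc N). P (w * of_real s) * w) \<longlonglongrightarrow> (LBINT s:{0<..}. P (w * of_real s) * w)"
    by (simp only:)
  from tendsto_add[OF this vertical_tendsto_0[OF r]]
  show "(\<lambda>N. contour_integral (ell_minus r N) P) \<longlonglongrightarrow> (LBINT s:{0<..}. P (w * of_real s) * w)"
    by (simp only: contour_integral_unique[OF I] add_0_right)
qed

section \<open>Rotating the principal value\<close>

text \<open>The slit points upwards so that the ray, the axis without 1, and small lower semicircles
  about 1 all lie in one domain with one primitive. The other pole -1 is outside the cone.\<close>

definition V :: "complex set" where "V = cone - {z. Re z = 1 \<and> Im z \<ge> 0}"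

lemma Q_holomorphic: "Q holomorphic_on V"
proof -
  have "1 - t\<^sup>2 \<noteq> 0" if "t \<in> V" for t
  proof
    assume "1 - t\<^sup>2 = 0"
    then have "t = 1 \<or> t = - 1" using power2_eq_1_iff[of t] by auto
    then show False using that by (auto simp: V_def cone_def)
  qed
  then show ?thesis unfolding Q_def
    by (intro holomorphic_intros holomorphic_on_subset[OF F_holomorphic]) (auto simp: V_def)
qed

text \<open>The point \<open>w\<close> serves as the centre of visibility: its real part is 1 and it
  lies below the slit.\<close>

lemma Q_primitive:
  obtains \<Phi> where "\<And>z. z \<in> V \<Longrightarrow> (\<Phi> has_field_derivative Q z) (at z)"
proof (rule slit_primitive[of cone w 1 Q])
  show "w \<in> cone" using K_pos by (simp add: cone_def w_simps)
qed (use convex_cone open_cone Q_holomorphic K_pos that in \<open>auto simp: w_simps V_def\<close>)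

lemma F_integrable: "set_integrable lborel {0<..} (\<lambda>t. F (of_real t))"
  using F_ray_integral(1)[of 1 "\<lambda>_. 1" 1] K_pos by simp

text \<open>Off the removed interval |1 - t^2| = |1 - t| |1 + t| >= \<epsilon>, so Q is dominated by
  F / \<epsilon>.\<close>

lemma Q_integrable:
  assumes \<epsilon>: "\<epsilon> > 0"
  shows "set_integrable lborel ({0<..} - {1 - \<epsilon><..<1 + \<epsilon>}) (\<lambda>t. Q (of_real t))"
proof -
  let ?A = "{0<..} - {1 - \<epsilon><..<1 + \<epsilon>}"
  have int: "integrable lborel (\<lambda>t. indicator {0<..} t *\<^sub>R F (of_real t))"
    using F_integrable by (simp add: set_integrable_def)
  have eq: "indicator ?A t *\<^sub>R Q (of_real t) = (indicator {0<..} t *\<^sub>R F (of_real t)) * of_real (indicator ?A t * (1 / (1 - t\<^sup>2)))" for t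
    by (auto simp: indicator_def Q_def)
  have "norm (indicator ?A t *\<^sub>R Q (of_real t)) \<le> norm ((indicator {0<..} t *\<^sub>R F (of_real t)) * of_real (1 / \<epsilon>))" for t
  proof -
    have "\<bar>indicator ?A t * (1 / (1 - t\<^sup>2))\<bar> \<le> 1 / \<epsilon>"
    proof (cases "t \<in> ?A")
      case True
      then have "\<epsilon> * 1 \<le> \<bar>1 - t\<bar> * \<bar>1 + t\<bar>" using \<epsilon> by (intro mult_mono) auto
      also have "\<dots> = \<bar>1 - t\<^sup>2\<bar>" by (simp add: power2_eq_square algebra_simps flip: abs_mult)
      finally show ?thesis using True \<epsilon> by (auto simp: indicator_def intro!: frac_le)
    qed (use \<epsilon> in auto)
    then show ?thesis unfolding eq norm_mult norm_of_real using \<epsilon> by (intro mult_left_mono) auto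
  qed
  moreover have "(\<lambda>t. indicator ?A t *\<^sub>R Q (of_real t)) \<in> borel_measurable lborel"
    unfolding eq using borel_measurable_integrable[OF int] by measurable
  ultimately show ?thesis unfolding set_integrable_def
    by (intro Bochner_Integration.integrable_bound[OF integrable_mult_left[OF int, of "of_real (1 / \<epsilon>)"]]) auto
qed

lemma M_integrand_eq_Q: "t > 0 \<Longrightarrow> complex_of_real (M_integrand \<alpha> \<nu> t) = Q (of_real t)"
  by (simp add: M_integrand_def Q_def F_of_real)

lemma M_integrand_integrable:
  assumes \<epsilon>: "\<epsilon> > 0"
  shows "set_integrable lborel ({0<..} - {1 - \<epsilon><..<1 + \<epsilon>}) (M_integrand \<alpha> \<nu>)"
    "of_real (LBINT t:{0<..} - {1 - \<epsilon><..<1 + \<epsilon>}. M_integrand \<alpha> \<nu> t) = (LBINT t:{0<..} - {1 - \<epsilon><..<1 + \<epsilon>}. Q (of_real t))"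
proof -
  let ?A = "{0<..} - {1 - \<epsilon><..<1 + \<epsilon>}"
  have eq: "indicator ?A t *\<^sub>R Q (of_real t) = complex_of_real (indicator ?A t *\<^sub>R M_integrand \<alpha> \<nu> t)" for t
    by (auto simp: indicator_def M_integrand_eq_Q)
  show "set_integrable lborel ?A (M_integrand \<alpha> \<nu>)"
    using Q_integrable[OF \<epsilon>] unfolding set_integrable_def eq by (simp only: complex_of_real_integrable_eq)
  show "of_real (LBINT t:?A. M_integrand \<alpha> \<nu> t) = (LBINT t:?A. Q (of_real t))"
    unfolding set_lebesgue_integral_def eq by (rule integral_complex_of_real[symmetric])
qed

text \<open>The difference is the integral of Q over the vertical segment at x, whose length is K x
  / 2.\<close>

lemma vertical_Q_diff:
  assumes \<Phi>: "\<And>z. z \<in> V \<Longrightarrow> (\<Phi> has_field_derivative Q z) (at z)"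
    and x: "x > 0" "x \<noteq> 1" and d: "\<And>z. Re z = x \<Longrightarrow> d \<le> norm (1 - z\<^sup>2)" "d > 0"
  shows "norm (\<Phi> (of_real x) - \<Phi> (w * of_real x)) \<le> S\<^sub>F / sqrt x / d * (K / 2 * x)"
proof -
  have Re: "Re z = x" "z \<in> cone" if "z \<in> closed_segment (w * of_real x) (of_real x)" for z
  proof -
    note R = Re_closed_segment_vertical[OF that x(1)]
    show "Re z = x" by (rule R)
    have "\<bar>Im z\<bar> \<le> K / 2 * x" using R by auto
    also have "\<dots> < K * x" using K_pos x by simp
    finally show "z \<in> cone" using R x by (simp add: cone_def)
  qed
  then have seg: "closed_segment (w * of_real x) (of_real x) \<subseteq> V"
    using x by (auto simp: V_def)
  have SF: "S\<^sub>F \<ge> 0" using order_trans[OF norm_ge_zero F_bound[OF of_real_in_cone[of 1]]] by simp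
  have "(Q has_contour_integral (\<Phi> (of_real x) - \<Phi> (w * of_real x))) (linepath (w * of_real x) (of_real x))"
    using contour_integral_primitive[of V \<Phi> Q "linepath (w * of_real x) (of_real x)"] \<Phi> seg
    by (auto simp: has_field_derivative_at_within)
  then have "norm (\<Phi> (of_real x) - \<Phi> (w * of_real x)) \<le> S\<^sub>F / sqrt x / d * norm (of_real x - w * of_real x)"
  proof (rule has_contour_integral_bound_linepath)
    show "0 \<le> S\<^sub>F / sqrt x / d" using SF x d by simp
    fix z assume "z \<in> closed_segment (w * of_real x) (of_real x)"
    note z = Re[OF this]
    have "norm (F z) * (1 / norm (1 - z\<^sup>2)) \<le> S\<^sub>F / sqrt x * (1 / d)"
      using F_bound[OF z(2)] z x d SF by (intro mult_mono frac_le) auto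
    then show "norm (Q z) \<le> S\<^sub>F / sqrt x / d"
      by (simp add: Q_def norm_mult norm_divide)
  qed
  also have "of_real x - w * of_real x = \<i> * of_real (K / 2 * x)"
    by (simp add: complex_eq_iff w_simps)
  also have "norm (\<i> * of_real (K / 2 * x)) = K / 2 * x"
    unfolding norm_mult norm_of_real using K_pos x by simp
  finally show ?thesis .
qed

text \<open>With d = 1 / 2 near 0 and d = x for large x, the previous bound becomes a multiple of
  sqrt x and of 1 / sqrt x respectively.\<close>

lemma vertical_Q_tendsto:
  assumes \<Phi>: "\<And>z. z \<in> V \<Longrightarrow> (\<Phi> has_field_derivative Q z) (at z)"
  shows "((\<lambda>x. \<Phi> (of_real x) - \<Phi> (w * of_real x)) \<longlongrightarrow> 0) (at_right 0)"
    and "((\<lambda>x. \<Phi> (of_real x) - \<Phi> (w * of_real x)) \<longlongrightarrow> 0) at_top"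
proof -
  show "((\<lambda>x. \<Phi> (of_real x) - \<Phi> (w * of_real x)) \<longlongrightarrow> 0) (at_right 0)"
  proof (rule Lim_null_comparison)
    have "eventually (\<lambda>x. x \<in> {0<..<1/2}) (at_right (0::real))"
      by (rule eventually_at_right_real) simp
    then show "\<forall>\<^sub>F x in at_right 0. norm (\<Phi> (of_real x) - \<Phi> (w * of_real x)) \<le> S\<^sub>F * K * sqrt x"
    proof eventually_elim
      case (elim x)
      have "norm (\<Phi> (of_real x) - \<Phi> (w * of_real x)) \<le> S\<^sub>F / sqrt x / (1 / 2) * (K / 2 * x)"
      proof (rule vertical_Q_diff[OF \<Phi>])
        show "1 / 2 \<le> norm (1 - z\<^sup>2)" if "Re z = x" for z
        proof -
          have "1 / 2 * 1 \<le> \<bar>1 - x\<bar> * (1 + x)" using elim by (intro mult_mono) auto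
          also have "\<dots> \<le> norm (1 - z\<^sup>2)" by (rule norm_one_minus_square_ge) (use elim that in auto)
          finally show ?thesis by simp
        qed
      qed (use elim in auto)
      also have "\<dots> = S\<^sub>F * K * (x / sqrt x)" by simp
      also have "x / sqrt x = sqrt x" using elim by (simp add: real_div_sqrt)
      finally show ?case .
    qed
    have "((\<lambda>x. S\<^sub>F * K * sqrt x) \<longlongrightarrow> S\<^sub>F * K * sqrt 0) (at_right 0)" by (intro tendsto_intros)
    then show "((\<lambda>x. S\<^sub>F * K * sqrt x) \<longlongrightarrow> 0) (at_right 0)" by simp
  qed
  show "((\<lambda>x. \<Phi> (of_real x) - \<Phi> (w * of_real x)) \<longlongrightarrow> 0) at_top"
  proof (rule Lim_null_comparison)
    show "\<forall>\<^sub>F x in at_top. norm (\<Phi> (of_real x) - \<Phi> (w * of_real x)) \<le> S\<^sub>F * (K / 2) * inverse (sqrt x)"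
      using eventually_ge_at_top[of 2]
    proof eventually_elim
      case (elim x)
      have "norm (\<Phi> (of_real x) - \<Phi> (w * of_real x)) \<le> S\<^sub>F / sqrt x / x * (K / 2 * x)"
      proof (rule vertical_Q_diff[OF \<Phi>])
        show "x \<le> norm (1 - z\<^sup>2)" if "Re z = x" for z
        proof -
          have "1 * x \<le> \<bar>1 - x\<bar> * (1 + x)" using elim by (intro mult_mono) auto
          also have "\<dots> \<le> norm (1 - z\<^sup>2)" by (rule norm_one_minus_square_ge) (use elim that in auto)
          finally show ?thesis by simp
        qed
      qed (use elim in auto)
      also have "\<dots> = S\<^sub>F * (K / 2) * inverse (sqrt x)" using elim by (simp add: field_simps)
      finally show ?case .
    qed
    have "((\<lambda>x. inverse (sqrt x)) \<longlongrightarrow> 0) at_top"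
      by (intro tendsto_inverse_0_at_top sqrt_at_top)
    then show "((\<lambda>x. S\<^sub>F * (K / 2) * inverse (sqrt x)) \<longlongrightarrow> 0) at_top"
      by (rule tendsto_mult_right_zero)
  qed
qed

lemma semicircle_Q_tendsto:
  assumes \<Phi>: "\<And>z. z \<in> V \<Longrightarrow> (\<Phi> has_field_derivative Q z) (at z)"
  shows "((\<lambda>\<epsilon>. \<Phi> (of_real (1 + \<epsilon>)) - \<Phi> (of_real (1 - \<epsilon>))) \<longlongrightarrow> - (\<i> * pi * F 1 / 2)) (at_right 0)"
proof (rule tendstoI)
  fix e :: real assume e: "e > 0"
  \<comment> \<open>Q t = k t / (t - 1) with k continuous at 1, so the residue of Q there is k 1 = -
    F 1 / 2.\<close>
  define k where "k t = - F t / (1 + t)" for t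
  have one: "1 \<in> cone" using of_real_in_cone[of 1] by simp
  have "isCont F 1"
    using F_holomorphic open_cone one holomorphic_on_imp_continuous_on continuous_on_eq_continuous_at by blast
  then have "isCont k 1" unfolding k_def by (intro continuous_intros) auto
  \<comment> \<open>An error e / (2 \<pi>) in k, divided by the radius and multiplied by the arc
    length \<pi> \<epsilon>, contributes e / 2.\<close>
  then obtain d1 where d1: "d1 > 0" "\<And>t. norm (t - 1) < d1 \<Longrightarrow> norm (k t - k 1) < e / (2 * pi)"
    using e unfolding continuous_at_eps_delta dist_norm by (metis divide_pos_pos mult_pos_pos pi_gt_zero zero_less_numeral)
  obtain d2 where d2: "d2 > 0" "ball 1 d2 \<subseteq> cone"
    using open_cone one open_contains_ball by blast
  define d where "d = min d1 d2"
  have "eventually (\<lambda>\<epsilon>. \<epsilon> \<in> {0<..<d}) (at_right 0)"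
    by (rule eventually_at_right_real) (use d1 d2 in \<open>simp add: d_def\<close>)
  then show "\<forall>\<^sub>F \<epsilon> in at_right 0. dist (\<Phi> (of_real (1 + \<epsilon>)) - \<Phi> (of_real (1 - \<epsilon>))) (- (\<i> * pi * F 1 / 2)) < e"
  proof eventually_elim
    case (elim \<epsilon>)
    let ?\<gamma> = "part_circlepath (of_real 1) \<epsilon> pi (2 * pi)"
    have on: "norm (z - 1) = \<epsilon>" "z \<in> V" if "z \<in> path_image ?\<gamma>" for z
    proof -
      show n: "norm (z - 1) = \<epsilon>" using lower_semicircle_points(1)[OF that] elim by simp
      then have "z \<in> cone" using d2 elim by (auto simp: d_def dist_norm norm_minus_commute)
      then show "z \<in> V" using lower_semicircle_avoids_slit(2)[OF that] elim by (auto simp: V_def)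
    qed
    have "(Q has_contour_integral (\<Phi> (pathfinish ?\<gamma>) - \<Phi> (pathstart ?\<gamma>))) ?\<gamma>"
      using contour_integral_primitive[of V \<Phi> Q ?\<gamma>] \<Phi> on(2) by (auto simp: has_field_derivative_at_within)
    then have "(Q has_contour_integral (\<Phi> (of_real (1 + \<epsilon>)) - \<Phi> (of_real (1 - \<epsilon>)))) ?\<gamma>"
      by (simp add: semicircle_endpoints del: pathstart_part_circlepath pathfinish_part_circlepath)
    from has_contour_integral_diff[OF this part_circlepath_simple_pole[of \<epsilon> "k 1" "of_real 1"]]
    have "((\<lambda>t. Q t - k 1 / (t - 1)) has_contour_integral
        (\<Phi> (of_real (1 + \<epsilon>)) - \<Phi> (of_real (1 - \<epsilon>)) - \<i> * pi * k 1)) ?\<gamma>"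
      using elim by simp
    then have "norm (\<Phi> (of_real (1 + \<epsilon>)) - \<Phi> (of_real (1 - \<epsilon>)) - \<i> * pi * k 1) \<le> (e / (2 * pi)) / \<epsilon> * \<epsilon> * (2 * pi - pi)"
    proof (rule has_contour_integral_bound_part_circlepath_strong[OF _ finite.emptyI])
      show "0 \<le> e / (2 * pi) / \<epsilon>" "0 < \<epsilon>" "pi \<le> 2 * pi" using e elim by auto
      fix z assume "z \<in> path_image ?\<gamma> - {}"
      then have z: "norm (z - 1) = \<epsilon>" "z \<in> V" using on by auto
      have "z \<noteq> 1" "1 + z \<noteq> 0" using z elim by (auto simp: V_def cone_def add_eq_0_iff)
      moreover have "1 - z\<^sup>2 = - ((z - 1) * (1 + z))" by (simp add: power2_eq_square algebra_simps)
      ultimately have "Q z = k z / (z - 1)" by (simp add: Q_def k_def mult.commute)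
      then have "Q z - k 1 / (z - 1) = (k z - k 1) / (z - 1)" by (simp add: diff_divide_distrib)
      then have "norm (Q z - k 1 / (z - 1)) = norm (k z - k 1) / \<epsilon>" using z by (simp add: norm_divide)
      also have "\<dots> \<le> (e / (2 * pi)) / \<epsilon>"
        using d1(2)[of z] z elim by (intro divide_right_mono) (auto simp: d_def)
      finally show "norm (Q z - k 1 / (z - 1)) \<le> e / (2 * pi) / \<epsilon>" .
    qed
    also have "\<dots> = e / 2" using elim by simp
    also have "\<dots> < e" using e by simp
    finally show ?case by (simp add: dist_norm k_def)
  qed
qed

text \<open>Since the verticals vanish, the primitive has the same limits \<open>L0\<close> at 0 and
  \<open>LT\<close> at infinity along axis and ray. The ray integral is their difference; the
  truncated axis integral misses only the increment from 1 - \<epsilon> to 1 + \<epsilon>, which the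
  semicircle computes.\<close>

lemma M_integrand_PV:
  obtains I where "has_PV_integral (M_integrand \<alpha> \<nu>) I {0<..} 1"
    "complex_of_real I = (LBINT s:{0<..}. Q (w * of_real s) * w) + \<i> * pi * F 1 / 2"
proof -
  obtain \<Phi> where \<Phi>: "\<And>z. z \<in> V \<Longrightarrow> (\<Phi> has_field_derivative Q z) (at z)"
    using Q_primitive by blast
  define J where "J \<epsilon> = (LBINT t:{0<..} - {1 - \<epsilon><..<1 + \<epsilon>}. M_integrand \<alpha> \<nu> t)" for \<epsilon>
  define R where "R = (LBINT s:{0<..}. Q (w * of_real s) * w)"
  note contQ = holomorphic_on_imp_continuous_on[OF Q_holomorphic]
  have inV: "of_real s \<in> V" if "s > 0" "s \<noteq> 1" for s
    using of_real_in_cone[OF that(1)] that by (simp add: V_def)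
  have rayV: "w * of_real s \<in> V" if "s > 0" for s
    using ray_in_cone[OF w_simps(1,3) that] that K_pos by (simp add: V_def w_simps)
  have vert0: "((\<lambda>x. \<Phi> (of_real x) - \<Phi> (w * of_real x)) \<longlongrightarrow> 0) (at_right 0)"
   and vertT: "((\<lambda>x. \<Phi> (of_real x) - \<Phi> (w * of_real x)) \<longlongrightarrow> 0) at_top"
    using vertical_Q_tendsto[OF \<Phi>] by blast+
  define L0 LT where "L0 = \<Phi> w - (LBINT s:{0<..1}. Q (w * of_real s) * w)"
    and "LT = \<Phi> w + (LBINT s:{1..}. Q (w * of_real s) * w)"
  have int: "set_integrable lborel A (\<lambda>s. Q (w * of_real s) * w)" if "A \<subseteq> {0<..}" "A \<in> sets borel" for A
    by (rule set_integrable_subset[OF Q_ray_integral(1)]) (use that in auto)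
  have i0: "set_integrable lborel {0<..1} (\<lambda>s. Q (w * of_real s) * w)" by (rule int) auto
  have iT: "set_integrable lborel {1..} (\<lambda>s. Q (w * of_real s) * w)" by (rule int) auto
  have "((\<lambda>s. \<Phi> (w * of_real s)) \<longlongrightarrow> \<Phi> (w * of_real 1) - (LBINT s:{0<..1}. Q (w * of_real s) * w)) (at_right 0)"
    by (rule tendsto_primitive_at_right_0[OF \<Phi> contQ]) (use rayV i0 in auto)
  then have "((\<lambda>s. \<Phi> (w * of_real s)) \<longlongrightarrow> L0) (at_right 0)"
    by (simp only: L0_def of_real_1 mult_1_right)
  from tendsto_add[OF vert0 this] have L0: "((\<lambda>s. \<Phi> (of_real s)) \<longlongrightarrow> L0) (at_right 0)" by simp
  have "((\<lambda>s. \<Phi> (w * of_real s)) \<longlongrightarrow> \<Phi> (w * of_real 1) + (LBINT s:{1..}. Q (w * of_real s) * w)) at_top"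
    by (rule tendsto_primitive_at_top[OF \<Phi> contQ]) (use rayV iT in auto)
  then have "((\<lambda>s. \<Phi> (w * of_real s)) \<longlongrightarrow> LT) at_top"
    by (simp only: LT_def of_real_1 mult_1_right)
  from tendsto_add[OF vertT this] have LT: "((\<lambda>s. \<Phi> (of_real s)) \<longlongrightarrow> LT) at_top" by simp
  have R: "R = LT - L0"
  proof -
    \<comment> \<open>The pieces overlap in the null set {1}, whence the almost-everywhere form of
      additivity below.\<close>
    have *: "{0<..} = {0<..1} \<union> {1::real..}" by auto
    have "R = (LBINT s:{0<..1}. Q (w * of_real s) * w) + (LBINT s:{1..}. Q (w * of_real s) * w)"
      unfolding R_def * using AE_lborel_singleton[of 1]
      by (intro set_integral_Un_AE i0 iT) (auto elim!: eventually_mono)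
    then show ?thesis by (simp add: L0_def LT_def)
  qed
  have J: "of_real (J \<epsilon>) = R - (\<Phi> (of_real (1 + \<epsilon>)) - \<Phi> (of_real (1 - \<epsilon>)))" if \<epsilon>: "0 < \<epsilon>" "\<epsilon> < 1" for \<epsilon>
  proof -
    have split: "{0<..} - {1 - \<epsilon><..<1 + \<epsilon>} = {0<..1 - \<epsilon>} \<union> {1 + \<epsilon>..}" using \<epsilon> by auto
    have int: "set_integrable lborel {0<..1 - \<epsilon>} (\<lambda>s. Q (of_real s))" "set_integrable lborel {1 + \<epsilon>..} (\<lambda>s. Q (of_real s))"
      using Q_integrable[OF \<epsilon>(1)] by (auto intro: set_integrable_subset simp: split)
    have "((\<lambda>s. \<Phi> (1 * of_real s)) \<longlongrightarrow> \<Phi> (1 * of_real (1 - \<epsilon>)) - (LBINT s:{0<..1 - \<epsilon>}. Q (1 * of_real s) * 1)) (at_right 0)"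
      by (rule tendsto_primitive_at_right_0[OF \<Phi> contQ]) (use \<epsilon> int inV in auto)
    with L0 have 1: "(LBINT s:{0<..1 - \<epsilon>}. Q (of_real s)) = \<Phi> (of_real (1 - \<epsilon>)) - L0"
      using tendsto_unique[OF trivial_limit_at_right_real] by fastforce
    have "((\<lambda>s. \<Phi> (1 * of_real s)) \<longlongrightarrow> \<Phi> (1 * of_real (1 + \<epsilon>)) + (LBINT s:{1 + \<epsilon>..}. Q (1 * of_real s) * 1)) at_top"
      by (rule tendsto_primitive_at_top[OF \<Phi> contQ]) (use \<epsilon> int inV in auto)
    with LT have 2: "(LBINT s:{1 + \<epsilon>..}. Q (of_real s)) = LT - \<Phi> (of_real (1 + \<epsilon>))"
      using tendsto_unique[OF trivial_limit_at_top_linorder] by fastforce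
    have "of_real (J \<epsilon>) = (LBINT s:{0<..} - {1 - \<epsilon><..<1 + \<epsilon>}. Q (of_real s))"
      unfolding J_def by (rule M_integrand_integrable(2)[OF \<epsilon>(1)])
    also have "\<dots> = (LBINT s:{0<..1 - \<epsilon>}. Q (of_real s)) + (LBINT s:{1 + \<epsilon>..}. Q (of_real s))"
      unfolding split using \<epsilon> int by (intro set_integral_Un) auto
    finally show ?thesis using 1 2 R by simp
  qed
  have "((\<lambda>\<epsilon>. R - (\<Phi> (of_real (1 + \<epsilon>)) - \<Phi> (of_real (1 - \<epsilon>)))) \<longlongrightarrow> R - - (\<i> * pi * F 1 / 2)) (at_right 0)"
    by (intro tendsto_diff tendsto_const semicircle_Q_tendsto[OF \<Phi>])
  moreover have "\<forall>\<^sub>F \<epsilon> in at_right 0. R - (\<Phi> (of_real (1 + \<epsilon>)) - \<Phi> (of_real (1 - \<epsilon>))) = complex_of_real (J \<epsilon>)"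
    using eventually_at_right_real[of 0 1] by (auto elim!: eventually_mono simp: J)
  ultimately have lim: "((\<lambda>\<epsilon>. complex_of_real (J \<epsilon>)) \<longlongrightarrow> R + \<i> * pi * F 1 / 2) (at_right 0)"
    by (auto dest: Lim_transform_eventually)
  define I where "I = Re (R + \<i> * pi * F 1 / 2)"
  have limI: "(J \<longlongrightarrow> I) (at_right 0)"
    using tendsto_Re[OF lim] by (simp add: I_def)
  \<comment> \<open>The truncated integrals are real, hence so is their complex limit; taking the
    real part in \<open>I\<close> loses nothing.\<close>
  have "complex_of_real I = R + \<i> * pi * F 1 / 2"
    using tendsto_unique[OF trivial_limit_at_right_real tendsto_of_real[OF limI] lim] .
  moreover have "has_PV_integral (M_integrand \<alpha> \<nu>) I {0<..} 1"
    using limI M_integrand_integrable(1) unfolding has_PV_integral_def J_def by blast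
  ultimately show ?thesis using that by (simp add: R_def)
qed

section \<open>The logarithm of the infinite product\<close>

text \<open>The double series \<open>a m n\<close>: its rows are the Taylor series of the logarithm,
  valid for the principal branch as the norm of x q^m is below 1; its columns are geometric and sum
  to minus (cos + \<i> sin) / (N (E - 1)), whose real and imaginary parts yield the cosine sum and F
  1.\<close>

lemma log_qpochhammer_series:
  defines "x \<equiv> exp (2 * of_real pi * of_real \<nu> * \<i> - of_real (2 * pi / \<alpha>))"
    and "q \<equiv> exp (- complex_of_real (2 * pi / \<alpha>))"
  shows "summable (\<lambda>m. Ln (1 - x * q ^ m))"
    and "summable (\<lambda>n. M_cos_term \<alpha> \<nu> (Suc n))"
    and "log_qpochhammer x q = - of_real (\<Sum>n. M_cos_term \<alpha> \<nu> (Suc n)) - \<i> * F 1"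
proof -
  define \<rho> where "\<rho> = exp (- (2 * pi / \<alpha>))"
  have \<rho>: "0 < \<rho>" "\<rho> < 1" using \<alpha>_pos by (auto simp: \<rho>_def)
  have nx: "norm x = \<rho>" by (simp add: x_def \<rho>_def)
  have nq: "norm q = \<rho>" by (simp add: q_def \<rho>_def)
  define a where "a m n = - ((x * q ^ m) ^ Suc n) / of_nat (Suc n)" for m n
  have na: "norm (x * q ^ m) = \<rho> ^ Suc m" for m by (simp add: norm_mult norm_power nx nq)
  have row: "a m sums Ln (1 - x * q ^ m)" for m
  proof -
    have "norm (- (x * q ^ m)) < 1"
      using power_Suc_less_one[of \<rho> m] \<rho> na[of m] by simp
    from Ln_series'[OF this]
    have "(\<lambda>n. - ((x * q ^ m) ^ n) / of_nat n) sums Ln (1 - x * q ^ m)" by simp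
    \<comment> \<open>The term of index 0 is a division by zero, hence 0, so shifting the index does
      not change the sum.\<close>
    then show ?thesis
      unfolding a_def by (subst sums_Suc_iff[of "\<lambda>n. - ((x * q ^ m) ^ n) / of_nat n"]) simp
  qed
  have col: "(\<lambda>m. a m n) sums - (of_real (M_cos_term \<alpha> \<nu> (Suc n)) + \<i> * of_real (M_sin_term \<alpha> \<nu> 1 (Suc n)))" for n
  proof -
    define N where "N = Suc n"
    have N: "N > 0" by (simp add: N_def)
    have qN: "norm (q ^ N) < 1" using \<rho> N by (simp add: norm_power nq power_less_one_iff)
    have "(\<lambda>m. - (x ^ N) / of_nat N * (q ^ N) ^ m) sums (- (x ^ N) / of_nat N * (1 / (1 - q ^ N)))"
      by (intro sums_mult geometric_sums qN)
    moreover have "- (x ^ N) / of_nat N * (q ^ N) ^ m = a m n" for m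
      by (simp add: a_def N_def[symmetric] power_mult_distrib power_mult[symmetric] mult.commute)
    moreover have "- (x ^ N) / of_nat N * (1 / (1 - q ^ N)) =
        - (of_real (M_cos_term \<alpha> \<nu> N) + \<i> * of_real (M_sin_term \<alpha> \<nu> 1 N))"
    proof -
      define \<theta> where "\<theta> = 2 * real N * pi * \<nu>"
      define E where "E = exp (2 * real N * pi / \<alpha>)"
      have E: "E > 1" using \<alpha>_pos N by (simp add: E_def)
      have qN': "q ^ N = of_real (1 / E)"
      proof -
        have "\<rho> ^ N = exp (- (2 * real N * pi / \<alpha>))"
          unfolding \<rho>_def exp_of_nat_mult[symmetric] by (simp add: mult_ac)
        moreover have "q = of_real \<rho>" unfolding q_def \<rho>_def by (metis exp_of_real of_real_minus)
        ultimately show ?thesis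
          by (simp only: of_real_power[symmetric] E_def exp_minus inverse_eq_divide)
      qed
      have xN: "x ^ N = cis \<theta> * of_real (1 / E)"
      proof -
        have "x = cis (2 * pi * \<nu>) * q"
          by (simp add: x_def q_def cis_conv_exp exp_diff exp_minus divide_inverse mult_ac)
        then have "x ^ N = cis (2 * pi * \<nu>) ^ N * q ^ N" by (simp add: power_mult_distrib)
        then show ?thesis by (simp only: qN' Complex.DeMoivre \<theta>_def mult_ac)
      qed
      have "x ^ N * (1 / (1 - q ^ N)) = cis \<theta> * of_real (1 / E * (1 / (1 - 1 / E)))"
        unfolding xN qN' by simp
      also have "1 / E * (1 / (1 - 1 / E)) = 1 / (E - 1)" using E by (simp add: field_simps)
      finally have *: "x ^ N * (1 / (1 - q ^ N)) = cis \<theta> * of_real (1 / (E - 1))" .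
      have c: "M_cos_term \<alpha> \<nu> N = cos \<theta> / (real N * (E - 1))"
        by (simp add: M_cos_term_def \<theta>_def E_def)
      have s: "M_sin_term \<alpha> \<nu> 1 N = sin \<theta> / (real N * (E - 1))"
        by (simp add: M_sin_term_def \<theta>_def E_def mult_ac)
      have "- (x ^ N) / of_nat N * (1 / (1 - q ^ N)) = - (x ^ N * (1 / (1 - q ^ N))) / of_nat N" by simp
      also have "\<dots> = - (cis \<theta> * of_real (1 / (E - 1))) / of_real (real N)" by (simp only: * of_real_of_nat_eq)
      also have "\<dots> = - (cis \<theta> * of_real (1 / (real N * (E - 1))))" by (simp add: mult.commute)
      also have "\<dots> = - (of_real (M_cos_term \<alpha> \<nu> N) + \<i> * of_real (M_sin_term \<alpha> \<nu> 1 N))"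
        unfolding c s cis.code by (simp add: complex_eq_iff)
      finally show ?thesis .
    qed
    ultimately show ?thesis by (simp add: N_def)
  qed
  have abs: "(\<lambda>z. norm (case z of (m, n) \<Rightarrow> a m n)) summable_on (UNIV \<times> UNIV)"
  proof (rule Infinite_Sum.abs_summable_on_comparison_test[OF abs_summable_on_geometric_product[of \<rho>]])
    fix z :: "nat \<times> nat"
    obtain m n where z: "z = (m, n)" by (cases z)
    have "norm (a m n) \<le> \<rho> ^ (Suc m * Suc n) / 1"
      unfolding a_def norm_divide norm_minus_cancel norm_power na power_mult[symmetric]
      using \<rho> by (intro frac_le) (auto simp del: of_nat_Suc power_Suc)
    \<comment> \<open>(m + 1) (n + 1) >= m + n, which reduces the majorant to a product of two
      geometric series.\<close>
    also have "\<dots> \<le> \<rho> ^ (m + n)" using \<rho> by (simp del: power_Suc)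
    finally show "norm (case z of (m, n) \<Rightarrow> a m n) \<le> norm (case z of (m, n) \<Rightarrow> \<rho> ^ m * \<rho> ^ n)"
      using \<rho> by (simp add: z power_add)
  qed (use \<rho> in auto)
  note D = double_series_swap[OF abs row col]
  show "summable (\<lambda>m. Ln (1 - x * q ^ m))" by (rule D)
  \<comment> \<open>Up to sign, the cosine terms are the real parts of the column sums, which
    \<open>double_series_swap\<close> has shown summable.\<close>
  have "summable (\<lambda>n. Re (- (- (of_real (M_cos_term \<alpha> \<nu> (Suc n)) + \<i> * of_real (M_sin_term \<alpha> \<nu> 1 (Suc n))))))"
    by (intro summable_Re summable_minus D)
  then show cs: "summable (\<lambda>n. M_cos_term \<alpha> \<nu> (Suc n))" by simp
  have "(\<lambda>n. - (complex_of_real (M_cos_term \<alpha> \<nu> (Suc n)) + \<i> * of_real (M_sin_term \<alpha> \<nu> 1 (Suc n)))) sums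
      - (of_real (\<Sum>n. M_cos_term \<alpha> \<nu> (Suc n)) + \<i> * of_real (\<Sum>n. M_sin_term \<alpha> \<nu> 1 (Suc n)))"
    by (intro sums_minus sums_add sums_mult sums_of_real summable_sums cs M_sin_summable) simp
  from sums_unique[OF this] D(3)
  show "log_qpochhammer x q = - of_real (\<Sum>n. M_cos_term \<alpha> \<nu> (Suc n)) - \<i> * F 1"
    using F_of_real[of 1] by (simp add: log_qpochhammer_def)
qed

end

theorem theorem4:
  fixes \<alpha> \<nu> r :: real
  assumes "\<alpha> > 0" and "0 < r" and "r < 1"
  shows "summable (\<lambda>n. M_cos_term \<alpha> \<nu> (Suc n)) \<and>
    (\<forall>t>0. summable (\<lambda>n. M_sin_term \<alpha> \<nu> t (Suc n))) \<and>
    (\<exists>I. has_PV_integral (M_integrand \<alpha> \<nu>) I {0<..} 1) \<and>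
    (\<exists>I. has_ell_minus_integral (P_minus_integrand \<alpha> \<nu>) I r) \<and>
    summable (\<lambda>n. Ln (1 - exp (2 * of_real pi * of_real \<nu> * \<i> - of_real (2 * pi / \<alpha>))
                            * exp (- of_real (2 * pi / \<alpha>)) ^ n)) \<and>
    complex_of_real (M_fun \<alpha> \<nu>) =
      log_qpochhammer (exp (2 * of_real pi * of_real \<nu> * \<i> - of_real (2 * pi / \<alpha>)))
                      (exp (- of_real (2 * pi / \<alpha>)))
      + P_minus r \<alpha> \<nu>"
proof -
  interpret bose_sine \<alpha> \<nu> by standard (rule assms)
  obtain I where PV: "has_PV_integral (M_integrand \<alpha> \<nu>) I {0<..} 1"
    and I: "complex_of_real I = (LBINT s:{0<..}. Q (w * of_real s) * w) + \<i> * pi * F 1 / 2"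
    using M_integrand_PV by blast
  define R where "R = (LBINT s:{0<..}. P (w * of_real s) * w)"
  have ell: "has_ell_minus_integral P R r"
    unfolding R_def using assms by (intro P_has_ell_minus_integral)
  have "PV_integral {0<..} 1 (M_integrand \<alpha> \<nu>) = I"
    unfolding PV_integral_def using PV has_PV_integral_unique by blast
  then have "complex_of_real (M_fun \<alpha> \<nu>) = - of_real (\<Sum>n. M_cos_term \<alpha> \<nu> (Suc n)) - of_real (2 / pi) * complex_of_real I"
    by (simp add: M_fun_def)
  \<comment> \<open>The ray integral of Q times 2 / \<pi> is -R, and the half residue times 2 /
    \<pi> is \<open>\<i> * F 1\<close>.\<close>
  also have "of_real (2 / pi) * complex_of_real I = - R + \<i> * F 1"
    unfolding I R_def Q_ray_integral(2) by (simp add: distrib_left)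
  finally have M: "complex_of_real (M_fun \<alpha> \<nu>) = - of_real (\<Sum>n. M_cos_term \<alpha> \<nu> (Suc n)) - \<i> * F 1 + R"
    by simp
  have "P_minus r \<alpha> \<nu> = R"
    unfolding P_minus_def ell_minus_integral_def
    using ell by (intro the_equality) (auto simp: has_ell_minus_integral_def intro: LIMSEQ_unique)
  then show ?thesis
    using M PV ell log_qpochhammer_series M_sin_summable by auto
qed

end
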